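(* Let $\mathbb{G}$ be a strongly connected directed graph (with positive edge weights) and $L\in\mathbb{R}^{n\times n}$ its Laplacian matrix. Let $v$ be a positive left eigenvector of $L$ corresponding to the eigenvalue zero, i.e. $v'L=0$ with all entries of $v$ positive, let $V=\mathrm{diag}\{v\}$ and $D_0=V^{-1/2}$. Then $$\overline\phi_{\mathrm{ess}}(L)=\overline\phi(D_0^{-1}LD_0)=\overline\phi(VL),\qquad \underline\phi_{\mathrm{ess}}(L)=\underline\phi(D_0^{-1}LD_0)=\underline\phi(VL).$$
   Context: Graphs. A weighted directed graph on nodes $1,\dots,n$ has positive edge weights; $a_{ji}>0$ is the weight of the edge $(i,j)$ directed from node $i$ to node $j$, and $a_{ji}=0$ if there is no such edge. It is strongly connected if every node has directed paths to all other nodes. The Laplacian $L=[l_{ij}]$ is $l_{ij}=-a_{ij}$ for $i\neq j$ and $l_{ii}=\sum_{j\neq i}a_{ij}$. Phases. For $C\in\mathbb{C}^{n\times n}$, the numerical range is $W(C)=\{x^*Cx:\|x\|=1\}$ and the angular numerical range is $W'(C)=\{x^*Cx:x\in\mathbb{C}^n,x\neq0\}$, a convex cone. The field angle $\delta(C)$ is the angle subtended by $W'(C)$ if $W'(C)$ contains no line through the origin, $\pi$ if it contains exactly one line through the origin, and $2\pi$ if it is all of $\mathbb{C}$. $C$ is sectorial if $0\notin W(C)$, quasi-sectorial if $\delta(C)<\pi$, and semi-sectorial if $\delta(C)\leq\pi$. The zero matrix is quasi-sectorial, has no phases, and by convention $\overline{\phi}(0)=-\infty$, $\underline{\phi}(0)=\infty$.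 A sectorial $C$ can be written $C=T^*DT$ with $T$ nonsingular and $D$ diagonal unitary, the diagonal entries of $D$ being unique up to permutation and lying in an arc of length less than $\pi$; the phases $\overline{\phi}(C)=\phi_1(C)\geq\dots\geq\phi_n(C)=\underline{\phi}(C)$ are the arguments of the diagonal entries of $D$, selected so that $\overline{\phi}(C)-\underline{\phi}(C)<\pi$. A quasi-sectorial $C$ of rank $r$ has a decomposition $C=U\begin{bmatrix}0&0\\0&C_s\end{bmatrix}U^*$ with $U$ unitary and $C_s\in\mathbb{C}^{r\times r}$ sectorial; its $r$ phases are those of $C_s$. A semi-sectorial $C$ of rank $r$ with $\delta(C)=\pi$ is of one of two kinds. (i) Rotated Hermitian: $W(C)$ is a straight segment with the origin in its relative interior, $C=T^*\mathrm{diag}\{0_{n-r},e^{j(\theta_0+\pi/2)}I,e^{j(\theta_0-\pi/2)}I\}T$ with $T$ nonsingular, and its phases are the corresponding copies of $\theta_0+\pi/2$ and $\theta_0-\pi/2$. (ii) Otherwise $C=T^*\,\mathrm{diag}\{0_{n-r},D,E\}\,T$ with $T$ nonsingular, $D=\mathrm{diag}\{e^{j\theta_1},\dots,e^{j\theta_m}\}$, $\theta_0+\pi/2\geq\theta_1\geq\cdots\geq\theta_m\geq\theta_0-\pi/2$, and $E$ block diagonal with $(r-m)/2$ blocks $e^{j\theta_0}\begin{bmatrix}1&2\\0&1\end{bmatrix}$; its phases are $\theta_1,\dots,\theta_m$ together with $(r-m)/2$ copies of each of $\theta_0+\pi/2$ and $\theta_0-\pi/2$. $\overline{\phi}(C)$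 and $\underline{\phi}(C)$ are the largest and smallest phases. The phases take principal values if the phase center $\gamma(C)=[\overline{\phi}(C)+\underline{\phi}(C)]/2$ ($=\theta_0$ when $\delta(C)=\pi$) is selected in $(-\pi,\pi]$; principal values are used here. Essential phases. Let $\mathcal{D}$ be the set of positive definite diagonal matrices. For a matrix $C$ such that $D^{-1}CD$ is semi-sectorial for some $D\in\mathcal{D}$, $$\overline\phi_{\mathrm{ess}}(C)=\inf_{D\in\mathcal{D}}\overline\phi(D^{-1}CD),\qquad\underline\phi_{\mathrm{ess}}(C)=\sup_{D\in\mathcal{D}}\underline\phi(D^{-1}CD),$$ where the infimum and supremum are over those $D\in\mathcal{D}$ for which $D^{-1}CD$ is semi-sectorial and the phases take principal values. *)

theory Defs
  imports
    "HOL-Analysis.Line_Segment"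
    "HOL-Library.Extended_Real"
    "Jordan_Normal_Form.Gauss_Jordan_Elimination"
    "Jordan_Normal_Form.Schur_Decomposition"
    "Graph_Theory.Digraph_Component"
    "Graph_Theory.Pair_Digraph"
begin

section \<open>Weighted digraphs\<close>

text \<open>An arc \<open>(i, j)\<close> points from \<open>i\<close> to \<open>j\<close>, and its weight is the entry in row \<open>j\<close>, column \<open>i\<close>.\<close>

definition adjacency :: "nat pair_pre_digraph \<Rightarrow> (nat \<times> nat \<Rightarrow> real) \<Rightarrow> nat \<Rightarrow> nat \<Rightarrow> real" where
  "adjacency G w j i = (if (i, j) \<in> parcs G then w (i, j) else 0)"

definition laplacian :: "nat \<Rightarrow> nat pair_pre_digraph \<Rightarrow> (nat \<times> nat \<Rightarrow> real) \<Rightarrow> real mat" where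
  "laplacian n G w = mat n n (\<lambda>(i, j).
     if i \<noteq> j then - adjacency G w i j
     else (\<Sum>k\<in>{..<n} - {i}. adjacency G w i k))"


section \<open>Numerical range and sectoriality\<close>

text \<open>All matrices in this section are meant to be square.
  Since \<open>u \<bullet>c x\<close> conjugates its second argument,
  \<open>(C *\<^sub>v x) \<bullet>c x\<close> is \<open>x\<^sup>* C x\<close> and \<open>x \<bullet>c x = 1\<close> says that \<open>x\<close> has Euclidean norm 1.\<close>

definition numerical_range :: "complex mat \<Rightarrow> complex set" where
  "numerical_range C = {(C *\<^sub>v x) \<bullet>c x | x. x \<in> carrier_vec (dim_row C) \<and> x \<bullet>c x = 1}"

definition angular_numerical_range :: "complex mat \<Rightarrow> complex set" where
  "angular_numerical_range C =
     {(C *\<^sub>v x) \<bullet>c x | x. x \<in> carrier_vec (dim_row C) \<and> x \<noteq> 0\<^sub>v (dim_row C)}"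

definition line_through_origin :: "complex set \<Rightarrow> bool" where
  "line_through_origin l \<longleftrightarrow> (\<exists>z. z \<noteq> 0 \<and> l = range (\<lambda>t::real. complex_of_real t * z))"

text \<open>For a convex cone containing no line, the angle it subtends is the supremum of the
  unoriented angles between two of its nonzero elements; the inserted 0 covers the cone \<open>{0}\<close>.\<close>

definition subtended_angle :: "complex set \<Rightarrow> real" where
  "subtended_angle K = Sup (insert 0 {\<bar>Arg (z / y)\<bar> | y z. y \<in> K - {0} \<and> z \<in> K - {0}})"

text \<open>The angular numerical range is a convex cone, so that the last case below, in which it
  contains more than one line, is the case in which it is the whole complex plane.\<close>

definition field_angle :: "complex mat \<Rightarrow> real" where
  "field_angle C =
     (let K = angular_numerical_range C in
      if \<not> (\<exists>l. line_through_origin l \<and> l \<subseteq> K) then subtended_angle K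
      else if \<exists>!l. line_through_origin l \<and> l \<subseteq> K then pi
      else 2 * pi)"

definition sectorial :: "complex mat \<Rightarrow> bool" where
  "sectorial C \<longleftrightarrow> 0 \<notin> numerical_range C"

definition quasi_sectorial :: "complex mat \<Rightarrow> bool" where
  "quasi_sectorial C \<longleftrightarrow> field_angle C < pi"

definition semi_sectorial :: "complex mat \<Rightarrow> bool" where
  "semi_sectorial C \<longleftrightarrow> field_angle C \<le> pi"

definition rotated_hermitian :: "complex mat \<Rightarrow> bool" where
  "rotated_hermitian C \<longleftrightarrow>
     (\<exists>a b. numerical_range C = closed_segment a b \<and> 0 \<in> open_segment a b)"


section \<open>Phases\<close>

text \<open>\<open>C = T\<^sup>* M T\<close> with \<open>T\<close> nonsingular.\<close>

definition congruent_via :: "complex mat \<Rightarrow> complex mat \<Rightarrow> complex mat \<Rightarrow> bool" where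
  "congruent_via T C M \<longleftrightarrow>
     T \<in> carrier_mat (dim_row C) (dim_row C) \<and> invertible_mat T \<and>
     C = mat_adjoint T * M * T"

definition cis_diag :: "real list \<Rightarrow> complex mat" where
  "cis_diag ps = mat_diag (length ps) (\<lambda>i. cis (ps ! i))"

text \<open>The predicates below relate a matrix to the list of its phases, with multiplicity, in
  decreasing order and with principal values, i.e. with phase center in the interval from
  \<open>-\<pi>\<close> (excluded) to \<open>\<pi>\<close> (included).\<close>

definition sectorial_phases :: "complex mat \<Rightarrow> real list \<Rightarrow> bool" where
  "sectorial_phases C ps \<longleftrightarrow>
     length ps = dim_row C \<and> sorted_wrt (\<ge>) ps \<and>
     (\<exists>T. congruent_via T C (cis_diag ps)) \<and>
     (ps \<noteq> [] \<longrightarrow> hd ps - last ps < pi \<and> (hd ps + last ps) / 2 \<in> {-pi<..pi})"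

definition quasi_sectorial_phases :: "complex mat \<Rightarrow> real list \<Rightarrow> bool" where
  "quasi_sectorial_phases C ps \<longleftrightarrow>
     (\<exists>z r U Cs. z + r = dim_row C \<and>
        U \<in> carrier_mat (dim_row C) (dim_row C) \<and> U * mat_adjoint U = 1\<^sub>m (dim_row C) \<and>
        Cs \<in> carrier_mat r r \<and> sectorial Cs \<and>
        C = U * four_block_mat (0\<^sub>m z z) (0\<^sub>m z r) (0\<^sub>m r z) Cs * mat_adjoint U \<and>
        sectorial_phases Cs ps)"

definition rotated_hermitian_phases :: "complex mat \<Rightarrow> real list \<Rightarrow> bool" where
  "rotated_hermitian_phases C ps \<longleftrightarrow>
     (\<exists>z p q \<theta>\<^sub>0 T. z + p + q = dim_row C \<and> \<theta>\<^sub>0 \<in> {-pi<..pi} \<and>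
        ps = replicate p (\<theta>\<^sub>0 + pi / 2) @ replicate q (\<theta>\<^sub>0 - pi / 2) \<and>
        congruent_via T C (diag_block_mat [0\<^sub>m z z, cis_diag ps]))"

definition general_semi_sectorial_phases :: "complex mat \<Rightarrow> real list \<Rightarrow> bool" where
  "general_semi_sectorial_phases C ps \<longleftrightarrow>
     (\<exists>z k \<theta>s \<theta>\<^sub>0 T. z + length \<theta>s + 2 * k = dim_row C \<and> \<theta>\<^sub>0 \<in> {-pi<..pi} \<and>
        sorted_wrt (\<ge>) \<theta>s \<and> set \<theta>s \<subseteq> {\<theta>\<^sub>0 - pi / 2 .. \<theta>\<^sub>0 + pi / 2} \<and>
        congruent_via T C
          (diag_block_mat ([0\<^sub>m z z, cis_diag \<theta>s] @
             replicate k (cis \<theta>\<^sub>0 \<cdot>\<^sub>m mat_of_rows_list 2 [[1, 2], [0, 1]]))) \<and>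
        ps = replicate k (\<theta>\<^sub>0 + pi / 2) @ \<theta>s @ replicate k (\<theta>\<^sub>0 - pi / 2))"

definition is_phases :: "complex mat \<Rightarrow> real list \<Rightarrow> bool" where
  "is_phases C ps \<longleftrightarrow>
     (if quasi_sectorial C then quasi_sectorial_phases C ps
      else if field_angle C = pi then
        (if rotated_hermitian C then rotated_hermitian_phases C ps
         else general_semi_sectorial_phases C ps)
      else False)"

text \<open>The list is unique except for rotated Hermitian matrices, where \<open>\<theta>\<^sub>0\<close> is determined
  only modulo \<open>\<pi>\<close> and one admissible selection is made. It is unspecified for matrices that are
  not semi-sectorial.\<close>

definition phases :: "complex mat \<Rightarrow> real list" where
  "phases C = (SOME ps. is_phases C ps)"

definition phase_max :: "complex mat \<Rightarrow> ereal" where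
  "phase_max C =
     (if C = 0\<^sub>m (dim_row C) (dim_col C) then - \<infinity> else ereal (Max (set (phases C))))"

definition phase_min :: "complex mat \<Rightarrow> ereal" where
  "phase_min C =
     (if C = 0\<^sub>m (dim_row C) (dim_col C) then \<infinity> else ereal (Min (set (phases C))))"


section \<open>Essential phases\<close>

definition pos_diag_mats :: "nat \<Rightarrow> complex mat set" where
  "pos_diag_mats n = {mat_diag n (\<lambda>i. complex_of_real (d i)) | d. \<forall>i<n. d i > 0}"

definition similarity :: "complex mat \<Rightarrow> complex mat \<Rightarrow> complex mat" where
  "similarity D C = the (mat_inverse D) * C * D"

definition ess_phase_max :: "complex mat \<Rightarrow> ereal" where
  "ess_phase_max C =
     (INF D\<in>{D \<in> pos_diag_mats (dim_row C). semi_sectorial (similarity D C)}.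
        phase_max (similarity D C))"

definition ess_phase_min :: "complex mat \<Rightarrow> ereal" where
  "ess_phase_min C =
     (SUP D\<in>{D \<in> pos_diag_mats (dim_row C). semi_sectorial (similarity D C)}.
        phase_min (similarity D C))"

end

theory Submission
  imports Defs "Jordan_Normal_Form.Spectral_Radius"
begin

text \<open>
  The matrix \<open>VL\<close> has vanishing row and column sums, so \<open>Re (x\<^sup>* VL x)\<close> is half the sum of
  \<open>v\<^sub>i a\<^sub>i\<^sub>j \<bar>x\<^sub>i - x\<^sub>j\<bar>\<^sup>2\<close>: it is nonnegative and, by strong connectedness, vanishes only on constant
  vectors, which \<open>VL\<close> annihilates. Hence \<open>VL\<close> and the congruent matrix
  \<open>D\<^sub>0\<^sup>-\<^sup>1 L D\<^sub>0 = V\<^sup>-\<^sup>1\<^sup>/\<^sup>2 (VL) V\<^sup>-\<^sup>1\<^sup>/\<^sup>2\<close> are quasi-sectorial with the same angular numerical range inside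
  the right half-plane, and the extreme phases are the extreme arguments on that range.
  The infimum and supremum defining the essential phases run over a single matrix: the angular
  numerical range of a semi-sectorial matrix is not the whole plane, which forces its kernel into
  the kernel of its adjoint; for \<open>D\<^sup>-\<^sup>1 L D\<close> this makes \<open>D\<^sup>-\<^sup>2 1\<close> a left null vector of \<open>L\<close>, so
  \<open>D\<close> is a multiple of \<open>D\<^sub>0\<close>.
\<close>

unbundle no vec_syntax

section \<open>Adjoints and quadratic forms\<close>

text \<open>\<open>phases\<close> is a Hilbert choice among admissible lists, so nothing is known
  about it until some list is exhibited. Much of the proof therefore builds one: the spectral
  theorem for Hermitian matrices splits off the kernel, and a simultaneous diagonalization of the
  Hermitian and skew-Hermitian parts treats the rest. The chosen list is then under control because
  the extremes of every admissible list are the extreme values of \<open>Arg\<close> on the nonzero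
  part of the angular numerical range. The open half-plane alone bounds the field angle only by
  \<pi>; the same finite list supplies the strict inequality in quasi-sectoriality. That the left
  null vector of \<open>L\<close> is unique up to scaling comes from the same sum of squares that
  makes \<open>V * L\<close> accretive.\<close>

lemma dim_mat_adjoint [simp]:
  "dim_row (mat_adjoint A) = dim_col A" "dim_col (mat_adjoint A) = dim_row A"
  unfolding mat_adjoint_def by auto

lemma mat_adjoint_carrier [simp]:
  "A \<in> carrier_mat n m \<Longrightarrow> mat_adjoint A \<in> carrier_mat m n"
  by auto

lemma index_mat_adjoint [simp]:
  fixes A :: "complex mat"
  assumes "i < dim_col A" "j < dim_row A"
  shows "mat_adjoint A $$ (i, j) = cnj (A $$ (j, i))"
  using assms unfolding mat_adjoint_def by (simp add: mat_of_rows_index)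

lemma mat_adjoint_adjoint [simp]: "mat_adjoint (mat_adjoint A) = (A :: complex mat)"
  by (rule eq_matI) auto

lemma mat_adjoint_mult:
  fixes A B :: "complex mat"
  assumes "dim_col A = dim_row B"
  shows "mat_adjoint (A * B) = mat_adjoint B * mat_adjoint A"
  using assms by (intro eq_matI) (auto simp: scalar_prod_def mult.commute)

lemma mat_mult_assoc:
  fixes A B C :: "complex mat"
  assumes "dim_col A = dim_row B" "dim_col B = dim_row C"
  shows "A * B * C = A * (B * C)"
  using assms by (intro assoc_mult_mat[of A _ _ B _ C]) auto

lemma mat_vec_mult_assoc:
  fixes A B :: "complex mat"
  assumes "dim_col A = dim_row B" "dim_col B = dim_vec x"
  shows "(A * B) *\<^sub>v x = A *\<^sub>v (B *\<^sub>v x)"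
  using assms by (intro assoc_mult_mat_vec[of A _ _ B]) (auto intro: carrier_vecI)

lemma mat_adjoint_one [simp]: "mat_adjoint (1\<^sub>m n :: complex mat) = 1\<^sub>m n"
  by (rule eq_matI) auto

lemma mat_adjoint_mat_diag [simp]:
  "mat_adjoint (mat_diag n f) = mat_diag n (\<lambda>i. cnj (f i))"
  by (rule eq_matI) (auto simp: mat_diag_def)

lemma mat_adjoint_four_block:
  fixes A B C D :: "complex mat"
  assumes "A \<in> carrier_mat a a'" "B \<in> carrier_mat a b'"
    "C \<in> carrier_mat b a'" "D \<in> carrier_mat b b'"
  shows "mat_adjoint (four_block_mat A B C D) =
    four_block_mat (mat_adjoint A) (mat_adjoint C) (mat_adjoint B) (mat_adjoint D)"
  using assms by (intro eq_matI) auto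

lemma cscalar_prod_sum:
  fixes x y :: "complex vec"
  assumes "x \<in> carrier_vec n" "y \<in> carrier_vec n"
  shows "x \<bullet>c y = (\<Sum>i<n. x $ i * cnj (y $ i))"
  using assms by (auto simp: scalar_prod_def lessThan_atLeast0 intro!: sum.cong)

lemma cscalar_prod_self:
  fixes x :: "complex vec"
  assumes "x \<in> carrier_vec n"
  shows "x \<bullet>c x = complex_of_real (\<Sum>i<n. (cmod (x $ i))\<^sup>2)"
  using assms by (simp add: cscalar_prod_sum[of _ n] flip: complex_norm_square)

lemma adjoint_cscalar_prod:
  fixes A :: "complex mat"
  assumes "A \<in> carrier_mat n m" "x \<in> carrier_vec n" "y \<in> carrier_vec m"
  shows "(mat_adjoint A *\<^sub>v x) \<bullet>c y = x \<bullet>c (A *\<^sub>v y)"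
proof -
  have "(mat_adjoint A *\<^sub>v x) \<bullet>c y = (\<Sum>j<m. (\<Sum>i<n. cnj (A $$ (i, j)) * x $ i) * cnj (y $ j))"
    using assms by (subst cscalar_prod_sum[of _ m])
      (auto simp: scalar_prod_def lessThan_atLeast0 mult_mat_vec_carrier[of _ m n] intro!: sum.cong)
  also have "\<dots> = (\<Sum>i<n. \<Sum>j<m. cnj (A $$ (i, j)) * x $ i * cnj (y $ j))"
    by (subst sum.swap) (simp add: sum_distrib_right)
  also have "\<dots> = x \<bullet>c (A *\<^sub>v y)"
    using assms by (subst cscalar_prod_sum[of _ n])
      (auto simp: scalar_prod_def lessThan_atLeast0 sum_distrib_left mult_ac intro!: sum.cong)
  finally show ?thesis .
qed

lemma congruence_quadratic_form:
  fixes T M :: "complex mat"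
  assumes T: "T \<in> carrier_mat m n" and M: "M \<in> carrier_mat m m" and x: "x \<in> carrier_vec n"
  shows "((mat_adjoint T * M * T) *\<^sub>v x) \<bullet>c x = (M *\<^sub>v (T *\<^sub>v x)) \<bullet>c (T *\<^sub>v x)"
proof -
  have "(mat_adjoint T * M * T) *\<^sub>v x = mat_adjoint T *\<^sub>v (M *\<^sub>v (T *\<^sub>v x))"
    using assms by (simp add: mat_mult_assoc mat_vec_mult_assoc)
  then show ?thesis
    using assms by (simp add: adjoint_cscalar_prod[of T m n] mult_mat_vec_carrier[of _ m m] mult_mat_vec_carrier[of _ m n])
qed

lemma quadratic_form_mat_diag:
  assumes "x \<in> carrier_vec n"
  shows "(mat_diag n f *\<^sub>v x) \<bullet>c x = (\<Sum>i<n. f i * complex_of_real ((cmod (x $ i))\<^sup>2))"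
proof -
  have *: "(mat_diag n f *\<^sub>v x) $ i = f i * x $ i" if "i < n" for i
  proof -
    have "(mat_diag n f *\<^sub>v x) $ i = (\<Sum>j\<in>{0..<n}. (if i = j then f j else 0) * x $ j)"
      using that assms by (simp add: mat_diag_def scalar_prod_def)
    also have "\<dots> = (\<Sum>j\<in>{0..<n}. if i = j then f j * x $ j else 0)"
      by (rule sum.cong) auto
    finally show ?thesis using that by simp
  qed
  have "(mat_diag n f *\<^sub>v x) \<bullet>c x = (\<Sum>i<n. (mat_diag n f *\<^sub>v x) $ i * cnj (x $ i))"
    using assms by (intro cscalar_prod_sum) (auto simp: mult_mat_vec_carrier[of _ n n])
  also have "\<dots> = (\<Sum>i<n. f i * complex_of_real ((cmod (x $ i))\<^sup>2))"
    by (intro sum.cong) (auto simp: * mult.assoc simp flip: complex_norm_square)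
  finally show ?thesis .
qed

lemma mat_vec_cancel_left_inverse:
  fixes A B :: "complex mat"
  assumes "B * A = 1\<^sub>m n" "A \<in> carrier_mat n n" "B \<in> carrier_mat n n" "x \<in> carrier_vec n"
  shows "B *\<^sub>v (A *\<^sub>v x) = x"
  using assms mat_vec_mult_assoc[of B A x] by simp

section \<open>The spectral theorem for Hermitian matrices\<close>

definition unitary :: "nat \<Rightarrow> complex mat \<Rightarrow> bool" where
  "unitary n U \<longleftrightarrow> U \<in> carrier_mat n n \<and> mat_adjoint U * U = 1\<^sub>m n \<and> U * mat_adjoint U = 1\<^sub>m n"

lemma unitaryI:
  assumes "U \<in> carrier_mat n n" "mat_adjoint U * U = 1\<^sub>m n"
  shows "unitary n U"
  using assms mat_mult_left_right_inverse[of "mat_adjoint U" n U] by (auto simp: unitary_def)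

lemma unitary_mult:
  assumes "unitary n U" "unitary n W"
  shows "unitary n (U * W)"
proof (rule unitaryI)
  have c: "U \<in> carrier_mat n n" "W \<in> carrier_mat n n" using assms by (auto simp: unitary_def)
  show "U * W \<in> carrier_mat n n" using c by auto
  have "mat_adjoint (U * W) * (U * W) = mat_adjoint W * ((mat_adjoint U * U) * W)"
    using c by (simp add: mat_adjoint_mult mat_mult_assoc)
  then show "mat_adjoint (U * W) * (U * W) = 1\<^sub>m n"
    using assms by (auto simp: unitary_def)
qed

text \<open>The Householder reflection that exchanges \<open>x\<close> with the first unit vector;
  it exists because the first entry of \<open>x\<close> is real.\<close>

lemma unitary_first_column_real:
  assumes x: "x \<in> carrier_vec n" "0 < n" "x \<bullet>c x = 1" and re: "x $ 0 \<in> \<real>"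
  shows "\<exists>U. unitary n U \<and> col U 0 = x"
proof -
  define w where "w = (\<lambda>i. x $ i - (if i = 0 then 1 else 0 :: complex))"
  define s where "s = (\<Sum>k<n. w k * cnj (w k))"
  \<comment> \<open>For \<open>x\<close> equal to the first unit vector, \<open>w\<close> vanishes,
    \<open>s = 0\<close> and division by zero gives \<open>a = 0\<close>. The reflection then
    degenerates to the identity, which is the right matrix in that case.\<close>
  define a where "a = 2 / s"
  define U where "U = mat n n (\<lambda>(i, j). (if i = j then 1 else 0) - a * w i * cnj (w j))"
  have s_real: "s = complex_of_real (\<Sum>k<n. (cmod (w k))\<^sup>2)"
    by (simp add: s_def flip: complex_norm_square)
  have w0: "cnj (w 0) = w 0" using re by (simp add: w_def Reals_cnj_iff)
  have norm: "(\<Sum>k<n. x $ k * cnj (x $ k)) = 1"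
    using x by (simp add: cscalar_prod_sum[of x n x])
  \<comment> \<open>Unit length and a real first entry reduce the squared norm of \<open>w\<close>
    to \<open>2 - 2 * x $ 0\<close>. This is the relation by which the reflection carries the first
    unit vector to \<open>x\<close>.\<close>
  have "s = (\<Sum>k<n. x $ k * cnj (x $ k) + (if k = 0 then 1 - x $ 0 - cnj (x $ 0) else 0))"
    unfolding s_def by (intro sum.cong) (auto simp: w_def algebra_simps)
  also have "\<dots> = 2 - 2 * x $ 0"
    using \<open>0 < n\<close> re by (simp add: sum.distrib norm Reals_cnj_iff)
  finally have s: "s = - 2 * w 0" by (simp add: w_def)
  have a_real: "cnj a = a" by (simp add: a_def s_real)
  have adj: "mat_adjoint U = U"
    by (rule eq_matI) (auto simp: U_def a_real mult_ac)
  have as: "a * a * s = 2 * a" by (cases "s = 0") (auto simp: a_def)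
  have "U * U = 1\<^sub>m n"
  proof (rule eq_matI)
    fix i j assume "i < dim_row (1\<^sub>m n :: complex mat)" "j < dim_col (1\<^sub>m n :: complex mat)"
    then have ij: "i < n" "j < n" by auto
    have "(U * U) $$ (i, j) = (\<Sum>k<n. ((if i = k then 1 else 0) - a * w i * cnj (w k)) *
        ((if k = j then 1 else 0) - a * w k * cnj (w j)))"
      using ij by (auto simp: U_def scalar_prod_def lessThan_atLeast0 intro!: sum.cong)
    also have "\<dots> = (\<Sum>k<n. (if k = i then (if i = j then 1 else 0) - a * w i * cnj (w j) else 0)
        - (if k = j then a * w i * cnj (w j) else 0)
        + a * a * w i * cnj (w j) * (w k * cnj (w k)))"
      by (intro sum.cong) (auto simp: algebra_simps)
    also have "\<dots> = (if i = j then 1 else 0) - 2 * a * w i * cnj (w j) + (a * a * s) * w i * cnj (w j)"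
      using ij by (simp add: sum.distrib sum_subtractf s_def flip: sum_distrib_left)
    finally show "(U * U) $$ (i, j) = 1\<^sub>m n $$ (i, j)" using ij by (simp add: as)
  qed (auto simp: U_def)
  then have "unitary n U" by (intro unitaryI) (auto simp: adj, auto simp: U_def)
  moreover have "col U 0 = x"
  proof (rule eq_vecI)
    fix i assume "i < dim_vec x"
    then have i: "i < n" using x by auto
    have "a * w 0 * w i = - w i"
    proof (cases "s = 0")
      case True
      then have "(\<Sum>k<n. (cmod (w k))\<^sup>2) = 0" by (metis of_real_eq_0_iff s_real)
      then have "(cmod (w i))\<^sup>2 = 0" using i by (subst (asm) sum_nonneg_eq_0_iff) auto
      then show ?thesis by simp
    next
      case False
      then have "a * w 0 = - 1" using s by (simp add: a_def)
      then show ?thesis by simp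
    qed
    then have "col U 0 $ i = (if i = 0 then 1 else 0) + w i"
      using i \<open>0 < n\<close> by (simp add: U_def w0 mult_ac)
    then show "col U 0 $ i = x $ i" by (simp add: w_def)
  qed (use x in \<open>auto simp: U_def\<close>)
  ultimately show ?thesis by blast
qed

lemma unitary_first_column:
  assumes x: "x \<in> carrier_vec n" "0 < n" "x \<noteq> 0\<^sub>v n"
  shows "\<exists>U c. unitary n U \<and> col U 0 = c \<cdot>\<^sub>v x"
proof -
  define N where "N = sqrt (\<Sum>i<n. (cmod (x $ i))\<^sup>2)"
  \<comment> \<open>A factor of modulus 1 that rotates the first entry of \<open>x\<close> onto the
    real axis. The case split is there because \<open>sgn 0 = 0\<close> does not have modulus
    1.\<close>
  define p where "p = (if x $ 0 = 0 then 1 else cnj (sgn (x $ 0)))"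
  define c where "c = p / complex_of_real N"
  have "x \<bullet>c x \<noteq> 0" using x by simp
  then have "(\<Sum>i<n. (cmod (x $ i))\<^sup>2) \<noteq> 0"
    using x(1) by (metis cscalar_prod_self of_real_0)
  then have N: "N > 0" "N\<^sup>2 = (\<Sum>i<n. (cmod (x $ i))\<^sup>2)"
    unfolding N_def by (auto simp: sum_nonneg order_less_le)
  have "cmod p = 1" by (auto simp: p_def norm_sgn)
  then have "cmod c = 1 / N" using N by (simp add: c_def norm_divide)
  moreover have "(c \<cdot>\<^sub>v x) \<bullet>c (c \<cdot>\<^sub>v x) = complex_of_real ((cmod c)\<^sup>2 * (\<Sum>i<n. (cmod (x $ i))\<^sup>2))"
    using x(1) by (subst cscalar_prod_self[of _ n])
      (auto simp: norm_mult power_mult_distrib sum_distrib_left)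
  ultimately have "(c \<cdot>\<^sub>v x) \<bullet>c (c \<cdot>\<^sub>v x) = 1"
    using N(1) by (simp add: power_divide flip: N(2))
  moreover have "p * x $ 0 \<in> \<real>"
  proof -
    have "cnj (sgn z) * z \<in> \<real>" for z
      by (simp add: sgn_eq complex_is_Real_iff Im_divide_of_real mult.commute)
    then show ?thesis by (auto simp: p_def)
  qed
  then have "(c \<cdot>\<^sub>v x) $ 0 \<in> \<real>"
    using x by (simp add: c_def divide_simps Reals_divide)
  ultimately show ?thesis
    using unitary_first_column_real[of "c \<cdot>\<^sub>v x" n] x by auto
qed

lemma mult_block_diagonal:
  fixes A A' D D' :: "complex mat"
  assumes "A \<in> carrier_mat a a" "A' \<in> carrier_mat a a" "D \<in> carrier_mat b b" "D' \<in> carrier_mat b b"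
  shows "four_block_mat A (0\<^sub>m a b) (0\<^sub>m b a) D * four_block_mat A' (0\<^sub>m a b) (0\<^sub>m b a) D' =
    four_block_mat (A * A') (0\<^sub>m a b) (0\<^sub>m b a) (D * D')"
  using assms by (subst mult_four_block_mat[of _ a a _ b _ b _ _ a _ b]) auto

text \<open>Deflation: an eigenvector is completed to a unitary \<open>W\<close>, so the first
  column of \<open>N\<close> is \<open>k\<close> times the first unit vector. Symmetry of
  \<open>N\<close> clears the first row and makes \<open>k\<close> real, and the induction
  hypothesis diagonalizes the remaining block.\<close>

theorem hermitian_unitary_diagonalization:
  assumes "A \<in> carrier_mat n n" "mat_adjoint A = A"
  shows "\<exists>U d. unitary n U \<and> mat_adjoint U * A * U = mat_diag n (\<lambda>i. complex_of_real (d i))"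
  using assms
proof (induction n arbitrary: A)
  case 0
  then show ?case
    by (intro exI[of _ "1\<^sub>m 0"]) (auto simp: unitary_def intro!: eq_matI exI[of _ "\<lambda>_. 0"] simp: mat_diag_def)
next
  case (Suc m)
  have "spectrum A \<noteq> {}" using spectrum_non_empty[OF Suc.prems(1)] by simp
  then obtain k x where x: "x \<in> carrier_vec (Suc m)" "x \<noteq> 0\<^sub>v (Suc m)" "A *\<^sub>v x = k \<cdot>\<^sub>v x"
    using Suc.prems(1) by (auto simp: spectrum_def eigenvalue_def eigenvector_def)
  obtain W c where W: "unitary (Suc m) W" "col W 0 = c \<cdot>\<^sub>v x"
    using unitary_first_column[of x "Suc m"] x by auto
  have Wc: "W \<in> carrier_mat (Suc m) (Suc m)" "mat_adjoint W * W = 1\<^sub>m (Suc m)"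
    using W by (auto simp: unitary_def)
  define N where "N = mat_adjoint W * A * W"
  have Nc: "N \<in> carrier_mat (Suc m) (Suc m)" using Wc Suc.prems by (auto simp: N_def)
  have Nadj: "mat_adjoint N = N"
    unfolding N_def using Wc(1) Suc.prems
    by (simp add: mat_adjoint_mult mat_mult_assoc)
  have "A *\<^sub>v col W 0 = k \<cdot>\<^sub>v col W 0"
    using x Suc.prems(1) by (simp add: W mult_mat_vec[of _ "Suc m" "Suc m"] smult_smult_assoc mult.commute)
  moreover have "col W 0 \<in> carrier_vec (Suc m)" using Wc(1) by (auto intro: carrier_vecI)
  ultimately have "(mat_adjoint W * A) *\<^sub>v col W 0 = k \<cdot>\<^sub>v (mat_adjoint W *\<^sub>v col W 0)"
    using Wc(1) Suc.prems(1)
    by (simp add: mat_vec_mult_assoc mult_mat_vec[OF mat_adjoint_carrier[OF Wc(1)], of "col W 0" k])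
  then have "col N 0 = k \<cdot>\<^sub>v col (mat_adjoint W * W) 0"
    unfolding N_def using Wc(1) Suc.prems(1)
    by (subst (1 2) col_mult2[of _ "Suc m" "Suc m" _ "Suc m"]) auto
  then have N0: "N $$ (i, 0) = (if i = 0 then k else 0)" if "i < Suc m" for i
    using that Wc Nc by (auto dest!: arg_cong[of _ _ "\<lambda>v. v $ i"])
  have sym: "N $$ (i, j) = cnj (N $$ (j, i))" if "i < Suc m" "j < Suc m" for i j
    using that Nc by (subst Nadj[symmetric], subst index_mat_adjoint) auto
  have "cnj k = k" using sym[of 0 0] N0[of 0] by simp
  then have k: "k = complex_of_real (Re k)" by (simp add: complex_eq_iff)
  define B where "B = mat m m (\<lambda>(i, j). N $$ (Suc i, Suc j))"
  have Bc: "B \<in> carrier_mat m m" by (simp add: B_def)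
  have "mat_adjoint B = B"
    by (intro eq_matI) (auto simp: B_def simp flip: sym)
  then obtain U d where U: "unitary m U" "mat_adjoint U * B * U = mat_diag m (\<lambda>i. complex_of_real (d i))"
    using Suc.IH[of B] by (auto simp: B_def)
  then have Uc: "U \<in> carrier_mat m m" "mat_adjoint U * U = 1\<^sub>m m" by (auto simp: unitary_def)
  \<comment> \<open>Bordering by 1 makes \<open>U\<close> act on the lower block only; the
    eigenvalue \<open>k\<close> stays in position 0 and the others move up by one index.\<close>
  define F where "F = four_block_mat (1\<^sub>m 1) (0\<^sub>m 1 m) (0\<^sub>m m 1) U"
  have Fc: "F \<in> carrier_mat (Suc m) (Suc m)"
    unfolding F_def using four_block_carrier_mat[OF _ Uc(1), of "1\<^sub>m 1" 1 1] by auto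
  have Fadj: "mat_adjoint F = four_block_mat (1\<^sub>m 1) (0\<^sub>m 1 m) (0\<^sub>m m 1) (mat_adjoint U)"
    unfolding F_def using Uc
    by (subst mat_adjoint_four_block[of _ 1 1 _ m _ m]) (auto intro!: arg_cong2[of _ _ _ _ "\<lambda>x y. four_block_mat _ x y _"] eq_matI)
  have Nblock: "N = four_block_mat (mat 1 1 (\<lambda>_. k)) (0\<^sub>m 1 m) (0\<^sub>m m 1) B"
  proof (rule eq_matI)
    fix i j assume "i < dim_row (four_block_mat (mat 1 1 (\<lambda>_. k)) (0\<^sub>m 1 m) (0\<^sub>m m 1) B)"
      "j < dim_col (four_block_mat (mat 1 1 (\<lambda>_. k)) (0\<^sub>m 1 m) (0\<^sub>m m 1) B)"
    then have ij: "i < Suc m" "j < Suc m" by (auto simp: B_def)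
    then show "N $$ (i, j) = four_block_mat (mat 1 1 (\<lambda>_. k)) (0\<^sub>m 1 m) (0\<^sub>m m 1) B $$ (i, j)"
      using N0 sym[of i j] by (cases i; cases j) (auto simp: B_def)
  qed (use Nc in \<open>auto simp: B_def\<close>)
  have "unitary (Suc m) F"
  proof (rule unitaryI[OF Fc])
    show "mat_adjoint F * F = 1\<^sub>m (Suc m)"
      unfolding Fadj unfolding F_def using Uc
      by (simp add: mult_block_diagonal)
  qed
  then have "unitary (Suc m) (W * F)" using W unitary_mult by blast
  moreover have "mat_adjoint (W * F) * A * (W * F) = mat_adjoint F * N * F"
    unfolding N_def using Wc(1) Fc Suc.prems
    by (simp add: mat_adjoint_mult mat_mult_assoc)
  moreover have "mat_adjoint F * N * F =
      four_block_mat (mat 1 1 (\<lambda>_. k)) (0\<^sub>m 1 m) (0\<^sub>m m 1) (mat_adjoint U * B * U)"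
    unfolding Fadj Nblock unfolding F_def using Uc Bc
    by (simp add: mult_block_diagonal mult_carrier_mat[of _ m m])
  moreover have "\<dots> = mat_diag (Suc m) (\<lambda>i. complex_of_real (if i = 0 then Re k else d (i - 1)))"
    unfolding U by (rule eq_matI) (auto simp: mat_diag_def k[symmetric])
  ultimately show ?case by metis
qed

section \<open>Ordering the eigenvalues\<close>

lemma mat_diag_cong:
  assumes "\<And>i. i < n \<Longrightarrow> f i = g i"
  shows "mat_diag n f = mat_diag n g"
  using assms by (auto simp: mat_diag_def intro!: eq_matI)

lemma mat_mult_index_sum:
  assumes "A \<in> carrier_mat n m" "B \<in> carrier_mat m k" "i < n" "j < k"
  shows "(A * B) $$ (i, j) = (\<Sum>l<m. A $$ (i, l) * B $$ (l, j))"
  using assms by (auto simp: scalar_prod_def lessThan_atLeast0 intro!: sum.cong)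

text \<open>Entry \<open>(i, j)\<close> of the left side involves only columns \<open>f i\<close>
  and \<open>f j\<close> of \<open>U\<close>. With the identity as \<open>A\<close> this yields
  unitarity of the reordered basis, with the original matrix its reordered eigenvalues.\<close>

lemma congruence_permute_columns:
  fixes A U :: "complex mat"
  assumes "A \<in> carrier_mat n n" "U \<in> carrier_mat n n" "\<And>i. i < n \<Longrightarrow> f i < n"
  defines "P \<equiv> mat n n (\<lambda>(i, j). U $$ (i, f j))"
  shows "mat_adjoint P * A * P = mat n n (\<lambda>(i, j). (mat_adjoint U * A * U) $$ (f i, f j))"
proof (rule eq_matI)
  fix i j assume "i < dim_row (mat n n (\<lambda>(i, j). (mat_adjoint U * A * U) $$ (f i, f j)))"
    "j < dim_col (mat n n (\<lambda>(i, j). (mat_adjoint U * A * U) $$ (f i, f j)))"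
  then have ij: "i < n" "j < n" by auto
  have c: "mat_adjoint P * A \<in> carrier_mat n n" "mat_adjoint U * A \<in> carrier_mat n n" "P \<in> carrier_mat n n"
    using assms by (auto simp: P_def)
  have "(mat_adjoint P * A) $$ (i, k) = (mat_adjoint U * A) $$ (f i, k)" if "k < n" for k
    using that ij assms by (simp add: scalar_prod_def)
  then have "(mat_adjoint P * A * P) $$ (i, j) = (mat_adjoint U * A * U) $$ (f i, f j)"
    unfolding mat_mult_index_sum[OF c(1,3) ij] mat_mult_index_sum[OF c(2) assms(2) assms(3)[OF ij(1)] assms(3)[OF ij(2)]]
    using ij by (intro sum.cong) (auto simp: P_def)
  then show "(mat_adjoint P * A * P) $$ (i, j) =
      mat n n (\<lambda>(i, j). (mat_adjoint U * A * U) $$ (f i, f j)) $$ (i, j)"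
    using ij by simp
qed (auto simp: P_def)

text \<open>The order serves two purposes: phases are listed monotonically, and the zero eigenvalues
  of a positive semidefinite matrix come first, where the definition of the phases of a
  quasi-sectorial matrix places its zero block.\<close>

theorem hermitian_unitary_diagonalization_sorted:
  assumes A: "A \<in> carrier_mat n n" "mat_adjoint A = A"
  shows "\<exists>U d. unitary n U \<and> mat_adjoint U * A * U = mat_diag n (\<lambda>i. complex_of_real (d i)) \<and>
    mono_on {..<n} d"
proof -
  obtain U d where U: "unitary n U" "mat_adjoint U * A * U = mat_diag n (\<lambda>i. complex_of_real (d i))"
    using hermitian_unitary_diagonalization[OF A] by blast
  then have Uc: "U \<in> carrier_mat n n" "mat_adjoint U * U = 1\<^sub>m n" by (auto simp: unitary_def)
  define xs where "xs = sort_key d [0..<n]"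
  have xs: "length xs = n" "distinct xs" "set xs = {0..<n}" "sorted (map d xs)"
    by (auto simp: xs_def)
  have f: "xs ! i < n" if "i < n" for i using that xs nth_mem[of i xs] by auto
  define P where "P = mat n n (\<lambda>(i, j). U $$ (i, xs ! j))"
  have Pc: "P \<in> carrier_mat n n" by (simp add: P_def)
  have "mat_adjoint P * 1\<^sub>m n * P = 1\<^sub>m n"
    unfolding P_def using Uc xs f
    by (subst congruence_permute_columns[of _ n]) (auto simp: nth_eq_iff_index_eq intro!: eq_matI)
  then have "unitary n P" using Pc by (intro unitaryI) (auto simp: right_mult_one_mat[of _ n])
  moreover have "mat_adjoint P * A * P = mat_diag n (\<lambda>i. complex_of_real (d (xs ! i)))"
    unfolding P_def using Uc xs f A
    by (subst congruence_permute_columns[of _ n])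
      (auto simp: nth_eq_iff_index_eq U mat_diag_def intro!: eq_matI)
  moreover have "mono_on {..<n} (\<lambda>i. d (xs ! i))"
    using sorted_nth_mono[OF xs(4)] xs(1) by (intro mono_onI) simp
  ultimately show ?thesis by (intro exI[of _ P] exI[of _ "\<lambda>i. d (xs ! i)"]) simp
qed

section \<open>Accretive matrices and their phases\<close>

definition hermitian_part :: "complex mat \<Rightarrow> complex mat" where
  "hermitian_part C = (1 / 2) \<cdot>\<^sub>m (C + mat_adjoint C)"

lemma hermitian_part_carrier [simp]:
  "C \<in> carrier_mat n n \<Longrightarrow> hermitian_part C \<in> carrier_mat n n"
  by (simp add: hermitian_part_def)

lemma mat_adjoint_hermitian_part:
  "C \<in> carrier_mat n n \<Longrightarrow> mat_adjoint (hermitian_part C) = hermitian_part C"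
  by (rule eq_matI) (auto simp: hermitian_part_def)

text \<open>The second summand is the skew-Hermitian part \<open>(C - mat_adjoint C) / 2\<close>.
  Writing it through \<open>hermitian_part (\<i> \<cdot>\<^sub>m C)\<close> lets the facts on
  Hermitian parts serve for both summands.\<close>

lemma hermitian_decomposition:
  assumes "C \<in> carrier_mat n n"
  shows "C = hermitian_part C + (- \<i>) \<cdot>\<^sub>m hermitian_part (\<i> \<cdot>\<^sub>m C)"
  using assms by (intro eq_matI) (auto simp: hermitian_part_def field_simps)

lemma hermitian_part_mult_vec:
  assumes "C \<in> carrier_mat n n" "x \<in> carrier_vec n"
  shows "hermitian_part C *\<^sub>v x = (1 / 2) \<cdot>\<^sub>v (C *\<^sub>v x + mat_adjoint C *\<^sub>v x)"
  using assms by (intro eq_vecI)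
    (auto simp: hermitian_part_def scalar_prod_def distrib_right sum.distrib simp flip: sum_divide_distrib)

lemma quadratic_form_hermitian_part:
  assumes C: "C \<in> carrier_mat n n" and x: "x \<in> carrier_vec n"
  shows "(hermitian_part C *\<^sub>v x) \<bullet>c x = complex_of_real (Re ((C *\<^sub>v x) \<bullet>c x))"
proof -
  have Cx: "C *\<^sub>v x \<in> carrier_vec n" "mat_adjoint C *\<^sub>v x \<in> carrier_vec n"
    using C x by (auto simp: mult_mat_vec_carrier[of _ n n])
  have "(mat_adjoint C *\<^sub>v x) \<bullet>c x = x \<bullet>c (C *\<^sub>v x)"
    by (rule adjoint_cscalar_prod[OF C x x])
  also have "\<dots> = cnj ((C *\<^sub>v x) \<bullet>c x)"
    using Cx x by (simp add: cscalar_prod_sum[of _ n] mult.commute)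
  finally have "(hermitian_part C *\<^sub>v x) \<bullet>c x = ((C *\<^sub>v x) \<bullet>c x + cnj ((C *\<^sub>v x) \<bullet>c x)) / 2"
    using C x Cx by (simp add: hermitian_part_mult_vec[of C n] cscalar_prod_sum[of _ n]
      sum.distrib distrib_right flip: sum_divide_distrib)
  then show ?thesis by (simp add: complex_add_cnj)
qed

text \<open>Unlike in \<open>invertible_mat\<close>, the size of the inverse is part of the
  statement, so products with it can be reassociated at once.\<close>

definition regular :: "nat \<Rightarrow> complex mat \<Rightarrow> bool" where
  "regular n T \<longleftrightarrow> T \<in> carrier_mat n n \<and> (\<exists>S\<in>carrier_mat n n. S * T = 1\<^sub>m n \<and> T * S = 1\<^sub>m n)"

lemma regular_mult:
  assumes "regular n A" "regular n B"
  shows "regular n (A * B)"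
proof -
  obtain A' B' where c: "A \<in> carrier_mat n n" "B \<in> carrier_mat n n" "A' \<in> carrier_mat n n" "B' \<in> carrier_mat n n"
    and inv: "A' * A = 1\<^sub>m n" "A * A' = 1\<^sub>m n" "B' * B = 1\<^sub>m n" "B * B' = 1\<^sub>m n"
    using assms unfolding regular_def by blast
  have "B' * A' * (A * B) = B' * ((A' * A) * B)" "A * B * (B' * A') = A * ((B * B') * A')"
    using c by (auto simp: mat_mult_assoc)
  then have "B' * A' * (A * B) = 1\<^sub>m n" "A * B * (B' * A') = 1\<^sub>m n"
    using c inv by auto
  then show ?thesis
    unfolding regular_def using c by (intro conjI bexI[of _ "B' * A'"]) auto
qed

lemma regular_mat_diag:
  assumes "\<And>i. i < n \<Longrightarrow> f i \<noteq> 0"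
  shows "regular n (mat_diag n f)"
proof -
  have "mat_diag n (\<lambda>i. inverse (f i) * f i) = 1\<^sub>m n" "mat_diag n (\<lambda>i. f i * inverse (f i)) = 1\<^sub>m n"
    using assms by (auto simp: mat_diag_def intro!: eq_matI)
  then show ?thesis
    unfolding regular_def by (intro conjI bexI[of _ "mat_diag n (\<lambda>i. inverse (f i))"]) auto
qed

lemma unitary_imp_regular: "unitary n U \<Longrightarrow> regular n U"
  unfolding unitary_def regular_def using mat_adjoint_carrier by blast

lemma congruence_mult:
  fixes T W A :: "complex mat"
  assumes "T \<in> carrier_mat n n" "W \<in> carrier_mat n n" "A \<in> carrier_mat n n"
  shows "mat_adjoint (T * W) * A * (T * W) = mat_adjoint W * (mat_adjoint T * A * T) * W"
  using assms by (simp add: mat_adjoint_mult mat_mult_assoc)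

lemma congruence_add_smult:
  fixes T A B :: "complex mat"
  assumes "T \<in> carrier_mat n n" "A \<in> carrier_mat n n" "B \<in> carrier_mat n n"
  shows "mat_adjoint T * (A + k \<cdot>\<^sub>m B) * T = mat_adjoint T * A * T + k \<cdot>\<^sub>m (mat_adjoint T * B * T)"
proof -
  have "mat_adjoint T * (A + k \<cdot>\<^sub>m B) = mat_adjoint T * A + k \<cdot>\<^sub>m (mat_adjoint T * B)"
    using assms by (subst mult_add_distrib_mat[of _ n n _ n]) (auto simp: mult_smult_distrib[of _ n n _ n])
  then show ?thesis
    using assms by (simp add: add_mult_distrib_mat[of _ n n _ _ n] mult_carrier_mat[of _ n n _ n]
      mult_smult_assoc_mat[of _ n n _ n])
qed

text \<open>\<open>T\<close> is the unitary eigenbasis followed by division by the square roots of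
  the eigenvalues. These are positive because each is the value of the form at a column of
  \<open>U\<close>.\<close>

lemma positive_definite_congruent_one:
  assumes H: "H \<in> carrier_mat n n" "mat_adjoint H = H"
    and pos: "\<And>x. x \<in> carrier_vec n \<Longrightarrow> x \<noteq> 0\<^sub>v n \<Longrightarrow> Re ((H *\<^sub>v x) \<bullet>c x) > 0"
  shows "\<exists>T. regular n T \<and> mat_adjoint T * H * T = 1\<^sub>m n"
proof -
  obtain U h where U: "unitary n U" "mat_adjoint U * H * U = mat_diag n (\<lambda>i. complex_of_real (h i))"
    using hermitian_unitary_diagonalization[OF H] by blast
  then have Uc: "U \<in> carrier_mat n n" "mat_adjoint U * U = 1\<^sub>m n" by (auto simp: unitary_def)
  have h: "h i > 0" if i: "i < n" for i
  proof -
    have u: "unit_vec n i \<in> carrier_vec n" "unit_vec n i \<noteq> (0\<^sub>v n :: complex vec)"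
      using i by (auto dest: arg_cong[of _ _ "\<lambda>v. v $ i"])
    have "U *\<^sub>v unit_vec n i \<noteq> 0\<^sub>v n"
    proof
      assume 0: "U *\<^sub>v unit_vec n i = 0\<^sub>v n"
      have "mat_adjoint U *\<^sub>v (U *\<^sub>v unit_vec n i) = unit_vec n i"
        using Uc u by (intro mat_vec_cancel_left_inverse[of _ _ n]) auto
      moreover have "mat_adjoint U *\<^sub>v 0\<^sub>v n = 0\<^sub>v n"
        using Uc(1) by (intro eq_vecI) auto
      ultimately show False using 0 u(2) by simp
    qed
    moreover have "U *\<^sub>v unit_vec n i \<in> carrier_vec n" using Uc u by auto
    ultimately have "Re ((H *\<^sub>v (U *\<^sub>v unit_vec n i)) \<bullet>c (U *\<^sub>v unit_vec n i)) > 0"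
      by (intro pos)
    also have "(H *\<^sub>v (U *\<^sub>v unit_vec n i)) \<bullet>c (U *\<^sub>v unit_vec n i) =
        (\<Sum>k<n. complex_of_real (h k) * complex_of_real ((cmod (unit_vec n i $ k))\<^sup>2))"
      unfolding congruence_quadratic_form[OF Uc(1) H(1) u(1), symmetric] U(2)
      by (rule quadratic_form_mat_diag[OF u(1)])
    also have "\<dots> = (\<Sum>k<n. if k = i then complex_of_real (h k) else 0)"
      using i by (intro sum.cong) auto
    finally show ?thesis using i by simp
  qed
  define s where "s = (\<lambda>i. 1 / sqrt (h i))"
  define D where "D = mat_diag n (\<lambda>i. complex_of_real (s i))"
  have Dc: "D \<in> carrier_mat n n" by (simp add: D_def)
  have "regular n (U * D)"
    unfolding D_def s_def using h by (intro regular_mult unitary_imp_regular[OF U(1)] regular_mat_diag) force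
  moreover have "mat_adjoint (U * D) * H * (U * D) =
      mat_diag n (\<lambda>i. complex_of_real (s i * h i * s i))"
    unfolding congruence_mult[OF Uc(1) Dc H(1)] U(2) by (simp add: D_def)
  moreover have "\<dots> = mat_diag n (\<lambda>i. 1)"
  proof (rule mat_diag_cong)
    fix i assume "i < n"
    then have h: "sqrt (h i) > 0" "sqrt (h i) * sqrt (h i) = h i" using h by (auto simp: less_imp_le)
    have "1 / r * (r * r) * (1 / r) = 1" if "r > 0" for r :: real using that by simp
    from this[OF h(1)] have "s i * h i * s i = 1" unfolding h(2) s_def .
    then show "complex_of_real (s i * h i * s i) = 1" by (metis of_real_1)
  qed
  ultimately show ?thesis by (metis mat_diag_one)
qed

text \<open>The minus sign in front of \<open>\<i>\<close> turns the increasing \<open>e\<close> into decreasing phases.\<close>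

lemma strictly_accretive_congruent_diagonal:
  assumes C: "C \<in> carrier_mat n n"
    and pos: "\<And>x. x \<in> carrier_vec n \<Longrightarrow> x \<noteq> 0\<^sub>v n \<Longrightarrow> Re ((C *\<^sub>v x) \<bullet>c x) > 0"
  shows "\<exists>T e. regular n T \<and> mono_on {..<n} e \<and>
    mat_adjoint T * C * T = mat_diag n (\<lambda>i. 1 - \<i> * complex_of_real (e i))"
proof -
  let ?H = "hermitian_part C" and ?K = "hermitian_part (\<i> \<cdot>\<^sub>m C)"
  have Hc: "?H \<in> carrier_mat n n" "?K \<in> carrier_mat n n" using C by simp_all
  have "Re ((?H *\<^sub>v x) \<bullet>c x) > 0" if "x \<in> carrier_vec n" "x \<noteq> 0\<^sub>v n" for x
    using pos[OF that] by (simp add: quadratic_form_hermitian_part[OF C that(1)])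
  then obtain T where T: "regular n T" "mat_adjoint T * ?H * T = 1\<^sub>m n"
    using positive_definite_congruent_one[OF Hc(1) mat_adjoint_hermitian_part[OF C]] by blast
  then have Tc: "T \<in> carrier_mat n n" by (simp add: regular_def)
  have "mat_adjoint (mat_adjoint T * ?K * T) = mat_adjoint T * ?K * T"
    using C Tc mat_adjoint_hermitian_part[of "\<i> \<cdot>\<^sub>m C" n] carrier_matD[OF Hc(2)]
    by (simp add: mat_adjoint_mult mat_mult_assoc)
  moreover have "mat_adjoint T * ?K * T \<in> carrier_mat n n" using Tc Hc by auto
  \<comment> \<open>Congruence by the unitary \<open>W\<close> preserves the identity into which
    \<open>T\<close> turns \<open>?H\<close>, so \<open>T * W\<close> diagonalizes both parts
    simultaneously.\<close>
  ultimately obtain W e where W: "unitary n W"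
      "mat_adjoint W * (mat_adjoint T * ?K * T) * W = mat_diag n (\<lambda>i. complex_of_real (e i))"
      "mono_on {..<n} e"
    using hermitian_unitary_diagonalization_sorted by blast
  then have Wc: "W \<in> carrier_mat n n" "mat_adjoint W * W = 1\<^sub>m n" by (auto simp: unitary_def)
  have TW: "T * W \<in> carrier_mat n n" using Tc Wc by auto
  have "mat_adjoint (T * W) * C * (T * W) = 1\<^sub>m n + (- \<i>) \<cdot>\<^sub>m mat_diag n (\<lambda>i. complex_of_real (e i))"
    by (subst hermitian_decomposition[OF C], subst congruence_add_smult[OF TW Hc])
      (use T W Wc in \<open>simp add: congruence_mult[OF Tc Wc(1)] Hc\<close>)
  also have "\<dots> = mat_diag n (\<lambda>i. 1 - \<i> * complex_of_real (e i))"
    by (rule eq_matI) (auto simp: mat_diag_def)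
  finally show ?thesis
    using regular_mult[OF T(1) unitary_imp_regular[OF W(1)]] W(3) by blast
qed

lemma strictly_accretive_sectorial:
  assumes C: "C \<in> carrier_mat n n"
    and pos: "\<And>x. x \<in> carrier_vec n \<Longrightarrow> x \<noteq> 0\<^sub>v n \<Longrightarrow> Re ((C *\<^sub>v x) \<bullet>c x) > 0"
  shows "sectorial C"
proof -
  have "(C *\<^sub>v x) \<bullet>c x \<noteq> 0" if "x \<in> carrier_vec n" "x \<bullet>c x = 1" for x
  proof -
    have "x \<noteq> 0\<^sub>v n" using that(2) by auto
    from pos[OF that(1) this] show ?thesis by auto
  qed
  then show ?thesis using C unfolding sectorial_def numerical_range_def by force
qed

text \<open>The diagonal entries \<open>1 - \<i> * e i\<close> have argument
  \<open>- arctan (e i)\<close>. All these lie strictly between \<open>- pi / 2\<close> and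
  \<open>pi / 2\<close>, so the spread is below \<pi> and the center is automatically
  principal.\<close>

lemma strictly_accretive_phases:
  assumes C: "C \<in> carrier_mat n n"
    and pos: "\<And>x. x \<in> carrier_vec n \<Longrightarrow> x \<noteq> 0\<^sub>v n \<Longrightarrow> Re ((C *\<^sub>v x) \<bullet>c x) > 0"
  shows "\<exists>ps. sectorial_phases C ps"
proof -
  obtain T e where T: "regular n T" and e: "mono_on {..<n} e"
    and diag: "mat_adjoint T * C * T = mat_diag n (\<lambda>i. 1 - \<i> * complex_of_real (e i))"
    using strictly_accretive_congruent_diagonal[OF assms] by blast
  have Tc: "T \<in> carrier_mat n n" using T by (simp add: regular_def)
  define ps where "ps = map (\<lambda>i. - arctan (e i)) [0..<n]"
  have len: "length ps = dim_row C" using C by (simp add: ps_def)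
  \<comment> \<open>A congruence by a real diagonal matrix multiplies each entry by a square. The
    fourth root makes that square the reciprocal of the modulus of
    \<open>1 - \<i> * e i\<close>.\<close>
  define r where "r = (\<lambda>i. 1 / sqrt (sqrt (1 + (e i)\<^sup>2)))"
  define D where "D = mat_diag n (\<lambda>i. complex_of_real (r i))"
  have Dc: "D \<in> carrier_mat n n" by (simp add: D_def)
  have q: "sqrt (1 + (e i)\<^sup>2) > 0" for i by (simp add: add_pos_nonneg)
  have r: "r i > 0" "r i * r i = 1 / sqrt (1 + (e i)\<^sup>2)" for i
    using q[of i] by (simp_all add: r_def add_pos_nonneg)
  have "regular n (T * D)"
    unfolding D_def using r(1) by (intro regular_mult T regular_mat_diag) (metis less_irrefl of_real_eq_0_iff)
  then obtain S where S: "S \<in> carrier_mat n n" "S * (T * D) = 1\<^sub>m n" "(T * D) * S = 1\<^sub>m n"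
    unfolding regular_def by blast
  have TD: "T * D \<in> carrier_mat n n" using Tc Dc by auto
  have "mat_adjoint (T * D) * C * (T * D) =
      mat_diag n (\<lambda>i. complex_of_real (r i * r i) * (1 - \<i> * complex_of_real (e i)))"
    unfolding congruence_mult[OF Tc Dc C] diag by (simp add: D_def mult_ac)
  also have "\<dots> = mat_diag n (\<lambda>i. cis (ps ! i))"
    by (rule mat_diag_cong) (simp add: r(2) ps_def complex_eq_iff cos_arctan sin_arctan)
  also have "\<dots> = cis_diag ps" by (simp add: cis_diag_def ps_def)
  finally have TC: "mat_adjoint (T * D) * C * (T * D) = cis_diag ps" .
  have "C = mat_adjoint ((T * D) * S) * C * ((T * D) * S)" using S C by simp
  also have "\<dots> = mat_adjoint S * cis_diag ps * S"
    unfolding congruence_mult[OF TD S(1) C] TC ..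
  finally have "congruent_via S C (cis_diag ps)"
    using S TD C unfolding congruent_via_def invertible_mat_def inverts_mat_def by auto
  moreover have "sorted_wrt (\<ge>) ps"
    using mono_onD[OF e] by (auto simp: sorted_wrt_iff_nth_less ps_def arctan_le_iff)
  moreover have "hd ps - last ps < pi \<and> (hd ps + last ps) / 2 \<in> {-pi<..pi}" if "ps \<noteq> []"
  proof -
    have "\<bar>p\<bar> < pi / 2" if p: "p \<in> set ps" for p
    proof -
      obtain i where "p = - arctan (e i)" using p by (auto simp: ps_def)
      then show ?thesis using arctan_lbound[of "e i"] arctan_ubound[of "e i"] by (simp add: abs_less_iff)
    qed
    from this[of "hd ps"] this[of "last ps"] show ?thesis using that pi_gt_zero
      unfolding greaterThanAtMost_iff by (auto simp: abs_less_iff)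
  qed
  ultimately show ?thesis
    using len unfolding sectorial_phases_def by (intro exI[of _ ps]) blast
qed

section \<open>Splitting off the kernel\<close>

lemma quadratic_form_corner:
  fixes C :: "complex mat"
  assumes C: "C \<in> carrier_mat r r" and a: "a \<in> carrier_vec z" and b: "b \<in> carrier_vec r"
  shows "(four_block_mat (0\<^sub>m z z) (0\<^sub>m z r) (0\<^sub>m r z) C *\<^sub>v (a @\<^sub>v b)) \<bullet>c (a @\<^sub>v b) = (C *\<^sub>v b) \<bullet>c b"
proof -
  have Cb: "C *\<^sub>v b \<in> carrier_vec r" using C b by (rule mult_mat_vec_carrier)
  have 0: "0\<^sub>m k l *\<^sub>v x = 0\<^sub>v k" if "x \<in> carrier_vec l" for k l and x :: "complex vec"
    using that by (intro eq_vecI) auto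
  have "four_block_mat (0\<^sub>m z z) (0\<^sub>m z r) (0\<^sub>m r z) C *\<^sub>v (a @\<^sub>v b) =
      (0\<^sub>m z z *\<^sub>v a + 0\<^sub>m z r *\<^sub>v b) @\<^sub>v (0\<^sub>m r z *\<^sub>v a + C *\<^sub>v b)"
    using a b C by (intro four_block_mat_mult_vec) auto
  also have "\<dots> = 0\<^sub>v z @\<^sub>v (C *\<^sub>v b)" using a b Cb by (simp add: 0)
  finally have 1: "four_block_mat (0\<^sub>m z z) (0\<^sub>m z r) (0\<^sub>m r z) C *\<^sub>v (a @\<^sub>v b) = 0\<^sub>v z @\<^sub>v (C *\<^sub>v b)" .
  have "conjugate (a @\<^sub>v b) = conjugate a @\<^sub>v conjugate b"
    by (rule eq_vecI) auto
  then show ?thesis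
    unfolding 1 using a b Cb by (simp add: scalar_prod_append[of _ z _ r])
qed

lemma mult_unit_vec:
  fixes A :: "complex mat"
  assumes "A \<in> carrier_mat m n" "i < n"
  shows "A *\<^sub>v unit_vec n i = col A i"
  using assms by (intro eq_vecI) auto

text \<open>The implication sends the null vectors of the Hermitian part into the kernel of
  \<open>C\<close>. It keeps nonzero values of the form off the imaginary axis and makes the kernel
  split off by a unitary change of basis.\<close>

definition quasi_accretive :: "nat \<Rightarrow> complex mat \<Rightarrow> bool" where
  "quasi_accretive n C \<longleftrightarrow> C \<in> carrier_mat n n \<and>
     (\<forall>x\<in>carrier_vec n. Re ((C *\<^sub>v x) \<bullet>c x) \<ge> 0 \<and> (Re ((C *\<^sub>v x) \<bullet>c x) = 0 \<longrightarrow> C *\<^sub>v x = 0\<^sub>v n))"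

text \<open>In an eigenbasis of the Hermitian part, the vectors with eigenvalue 0 are annihilated by
  \<open>C\<close> and by its adjoint, so their rows and columns vanish. On the remaining corner the
  form has positive real part, and the strictly accretive case applies.\<close>

lemma quasi_accretive_phases:
  assumes qa: "quasi_accretive n C"
  shows "\<exists>ps. quasi_sectorial_phases C ps"
proof -
  have C: "C \<in> carrier_mat n n"
    and nonneg: "\<And>x. x \<in> carrier_vec n \<Longrightarrow> Re ((C *\<^sub>v x) \<bullet>c x) \<ge> 0"
    and kern: "\<And>x. x \<in> carrier_vec n \<Longrightarrow> Re ((C *\<^sub>v x) \<bullet>c x) = 0 \<Longrightarrow> C *\<^sub>v x = 0\<^sub>v n"
    using qa by (auto simp: quasi_accretive_def)
  let ?H = "hermitian_part C"
  have Hc: "?H \<in> carrier_mat n n" using C by simp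
  obtain U h where U: "unitary n U" "mat_adjoint U * ?H * U = mat_diag n (\<lambda>i. complex_of_real (h i))"
      and mono: "mono_on {..<n} h"
    using hermitian_unitary_diagonalization_sorted[OF Hc mat_adjoint_hermitian_part[OF C]] by blast
  have Uc: "U \<in> carrier_mat n n" and UU: "mat_adjoint U * U = 1\<^sub>m n" "U * mat_adjoint U = 1\<^sub>m n"
    using U by (auto simp: unitary_def)
  define N where "N = mat_adjoint U * C * U"
  have Nc: "N \<in> carrier_mat n n" using Uc C by (auto simp: N_def)
  have CN: "C = U * N * mat_adjoint U"
  proof -
    have "U * N * mat_adjoint U = (U * mat_adjoint U) * C * (U * mat_adjoint U)"
      using Uc C unfolding N_def by (simp add: mat_mult_assoc del: UU)
    then show ?thesis using C UU by simp
  qed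
  have form: "complex_of_real (Re ((N *\<^sub>v y) \<bullet>c y)) =
      (\<Sum>i<n. complex_of_real (h i) * complex_of_real ((cmod (y $ i))\<^sup>2))"
    if y: "y \<in> carrier_vec n" for y
  proof -
    have Uy: "U *\<^sub>v y \<in> carrier_vec n" using Uc y by (rule mult_mat_vec_carrier)
    have "complex_of_real (Re ((N *\<^sub>v y) \<bullet>c y)) = (?H *\<^sub>v (U *\<^sub>v y)) \<bullet>c (U *\<^sub>v y)"
      unfolding N_def congruence_quadratic_form[OF Uc C y]
      by (rule quadratic_form_hermitian_part[OF C Uy, symmetric])
    also have "\<dots> = (\<Sum>i<n. complex_of_real (h i) * complex_of_real ((cmod (y $ i))\<^sup>2))"
      unfolding congruence_quadratic_form[OF Uc Hc y, symmetric] U(2)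
      by (rule quadratic_form_mat_diag[OF y])
    finally show ?thesis .
  qed
  have form': "Re ((N *\<^sub>v y) \<bullet>c y) = (\<Sum>i<n. h i * (cmod (y $ i))\<^sup>2)" if "y \<in> carrier_vec n" for y
    using form[OF that] by (simp only: of_real_mult[symmetric] of_real_sum[symmetric] of_real_eq_iff)
  have N_nonneg: "Re ((N *\<^sub>v y) \<bullet>c y) \<ge> 0" if "y \<in> carrier_vec n" for y
    unfolding N_def congruence_quadratic_form[OF Uc C that]
    by (rule nonneg) (rule mult_mat_vec_carrier[OF Uc that])
  have h_eq: "h i = Re ((N *\<^sub>v unit_vec n i) \<bullet>c unit_vec n i)" if i: "i < n" for i
  proof -
    have "(\<Sum>k<n. h k * (cmod (unit_vec n i $ k))\<^sup>2) = (\<Sum>k<n. if k = i then h k else 0)"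
      using i by (intro sum.cong) auto
    then show ?thesis using i by (simp add: form')
  qed
  have h0: "h i \<ge> 0" if "i < n" for i
    unfolding h_eq[OF that] by (rule N_nonneg) simp
  \<comment> \<open>The eigenvalues are nonnegative and increasing, so \<open>z\<close> counts the
    zeros among them. The alternative \<open>i = n\<close> yields \<open>z = n\<close> when all of
    them vanish.\<close>
  define z where "z = (LEAST i. i = n \<or> h i > 0)"
  have z: "z = n \<or> h z > 0" unfolding z_def by (rule LeastI[of _ n]) simp
  have "z \<le> n" unfolding z_def by (rule Least_le) simp
  define r where "r = n - z"
  have n: "n = z + r" using \<open>z \<le> n\<close> by (simp add: r_def)
  have hz: "h i = 0" if "i < z" for i
    using not_less_Least[OF that[unfolded z_def]] h0[of i] that \<open>z \<le> n\<close> by auto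
  have hpos: "h i > 0" if "z \<le> i" "i < n" for i
    using z mono_onD[OF mono, of z i] that by auto
  have N_zero: "N $$ (j, i) = 0 \<and> N $$ (i, j) = 0" if i: "i < z" and j: "j < n" for i j
  proof -
    have i': "i < n" using i \<open>z \<le> n\<close> by simp
    let ?u = "U *\<^sub>v unit_vec n i"
    have u: "?u \<in> carrier_vec n" using Uc by auto
    have "Re ((C *\<^sub>v ?u) \<bullet>c ?u) = 0"
      using h_eq[OF i'] hz[OF i] unfolding N_def by (subst (asm) congruence_quadratic_form[OF Uc C]) auto
    then have Cu: "C *\<^sub>v ?u = 0\<^sub>v n" by (rule kern[OF u])
    have "mat_adjoint U *\<^sub>v (?H *\<^sub>v ?u) = mat_diag n (\<lambda>i. complex_of_real (h i)) *\<^sub>v unit_vec n i"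
      unfolding U(2)[symmetric] using Uc Hc u by (simp add: mat_vec_mult_assoc)
    also have "\<dots> = 0\<^sub>v n"
      using hz[OF i] i' by (intro eq_vecI) (auto simp: mat_diag_def)
    finally have 1: "mat_adjoint U *\<^sub>v (?H *\<^sub>v ?u) = 0\<^sub>v n" .
    have "?H *\<^sub>v ?u = U *\<^sub>v (mat_adjoint U *\<^sub>v (?H *\<^sub>v ?u))"
      using UU Uc Hc u by (subst mat_vec_cancel_left_inverse[of U "mat_adjoint U" n]) auto
    also have "\<dots> = 0\<^sub>v n" unfolding 1 using Uc by (intro eq_vecI) auto
    finally have Hu: "?H *\<^sub>v ?u = 0\<^sub>v n" .
    \<comment> \<open>The Hermitian part averages \<open>C\<close> and its adjoint; it and
      \<open>C\<close> annihilate \<open>?u\<close>, hence so does the adjoint.\<close>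
    have Cau: "mat_adjoint C *\<^sub>v ?u = 0\<^sub>v n"
    proof (rule eq_vecI)
      fix k assume "k < dim_vec (0\<^sub>v n :: complex vec)"
      then have k: "k < n" by simp
      have "(?H *\<^sub>v ?u) $ k = ((C *\<^sub>v ?u) $ k + (mat_adjoint C *\<^sub>v ?u) $ k) / 2"
        unfolding hermitian_part_mult_vec[OF C u] using k C by (simp del: index_mult_mat_vec)
      then show "(mat_adjoint C *\<^sub>v ?u) $ k = 0\<^sub>v n $ k"
        unfolding Hu Cu using k by simp
    qed (use C in auto)
    have "col N i = mat_adjoint U *\<^sub>v (C *\<^sub>v ?u)"
      unfolding mult_unit_vec[OF Nc i', symmetric] unfolding N_def using Uc C by (simp add: mat_vec_mult_assoc)
    moreover have "col (mat_adjoint N) i = mat_adjoint U *\<^sub>v (mat_adjoint C *\<^sub>v ?u)"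
      unfolding mult_unit_vec[OF mat_adjoint_carrier[OF Nc] i', symmetric] unfolding N_def
      using Uc C by (simp add: mat_vec_mult_assoc mat_adjoint_mult)
    moreover have "mat_adjoint U *\<^sub>v 0\<^sub>v n = 0\<^sub>v n" using Uc by (intro eq_vecI) auto
    ultimately have "col N i $ j = 0" "col (mat_adjoint N) i $ j = 0" using Cu Cau j by auto
    then show ?thesis using i' j Nc by auto
  qed
  define Cs where "Cs = mat r r (\<lambda>(i, j). N $$ (z + i, z + j))"
  have Csc: "Cs \<in> carrier_mat r r" by (simp add: Cs_def)
  have N_block: "N = four_block_mat (0\<^sub>m z z) (0\<^sub>m z r) (0\<^sub>m r z) Cs"
    using Nc n N_zero by (intro eq_matI) (auto simp: Cs_def)
  have pos: "Re ((Cs *\<^sub>v y) \<bullet>c y) > 0" if y: "y \<in> carrier_vec r" "y \<noteq> 0\<^sub>v r" for y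
  proof -
    let ?x = "0\<^sub>v z @\<^sub>v y"
    have x: "?x \<in> carrier_vec n" using y by (simp add: n)
    have "\<exists>k<r. y $ k \<noteq> 0"
      using y by (auto intro!: eq_vecI)
    then obtain k where k: "k < r" "y $ k \<noteq> 0" by blast
    have "0 < h (z + k) * (cmod (?x $ (z + k)))\<^sup>2"
      using hpos[of "z + k"] k y n by simp
    also have "\<dots> \<le> (\<Sum>i<n. h i * (cmod (?x $ i))\<^sup>2)"
      by (rule member_le_sum) (use k h0 n in auto)
    also have "\<dots> = Re ((N *\<^sub>v ?x) \<bullet>c ?x)" using form'[OF x] ..
    also have "(N *\<^sub>v ?x) \<bullet>c ?x = (Cs *\<^sub>v y) \<bullet>c y"
      unfolding N_block by (rule quadratic_form_corner[OF Csc _ y(1)]) simp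
    finally show ?thesis .
  qed
  obtain ps where ps: "sectorial_phases Cs ps"
    using strictly_accretive_phases[OF Csc pos] by blast
  have "quasi_sectorial_phases C ps"
    unfolding quasi_sectorial_phases_def carrier_matD(1)[OF C]
    by (intro exI conjI) (rule n[symmetric] Uc UU(2) Csc strictly_accretive_sectorial[OF Csc pos]
      CN[unfolded N_block] ps | assumption)+
  then show ?thesis ..
qed

section \<open>Phases and the angular numerical range\<close>

lemma abs_less_pi_half_if_cos_pos:
  assumes "\<bar>t\<bar> \<le> pi" "cos t > 0"
  shows "\<bar>t\<bar> < pi / 2"
proof (rule ccontr)
  assume "\<not> \<bar>t\<bar> < pi / 2"
  then have "cos \<bar>t\<bar> \<le> cos (pi / 2)" using assms(1) by (intro cos_monotone_0_pi_le) auto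
  then show False using assms(2) by simp
qed

lemma abs_Arg_less_pi_half:
  assumes "Re z > 0"
  shows "\<bar>Arg z\<bar> < pi / 2"
proof (rule abs_less_pi_half_if_cos_pos)
  show "\<bar>Arg z\<bar> \<le> pi" using Arg_bounded[of z] by auto
  have "z \<noteq> 0" using assms by auto
  then show "cos (Arg z) > 0" using assms by (simp add: cos_Arg)
qed

text \<open>Rotating by \<open>- \<gamma>\<close> and taking imaginary parts gives
  \<open>cmod z * sin (Arg z - \<gamma>)\<close> as the sum of the
  \<open>c k * sin (p k - \<gamma>)\<close>. For \<open>\<gamma> = \<alpha>\<close> no summand is
  positive, whereas \<open>Arg z > \<alpha>\<close> would make the left side positive, since all
  angles lie within \<pi> of each other. The choice \<open>\<gamma> = \<beta>\<close> is
  symmetric.\<close>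

lemma Arg_cone_bounds:
  fixes p c :: "nat \<Rightarrow> real"
  assumes z: "z = (\<Sum>k<r. complex_of_real (c k) * cis (p k))" "Re z > 0"
    and c: "\<And>k. k < r \<Longrightarrow> c k \<ge> 0" and p: "\<And>k. k < r \<Longrightarrow> \<beta> \<le> p k \<and> p k \<le> \<alpha>"
    and bounds: "- (pi / 2) < \<beta>" "\<beta> \<le> \<alpha>" "\<alpha> < pi / 2"
  shows "\<beta> \<le> Arg z \<and> Arg z \<le> \<alpha>"
proof -
  have "z \<noteq> 0" using z(2) by auto
  have arg: "\<bar>Arg z\<bar> < pi / 2" using z(2) by (rule abs_Arg_less_pi_half)
  have rot: "cmod z * sin (Arg z - \<gamma>) = (\<Sum>k<r. c k * sin (p k - \<gamma>))" for \<gamma>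
  proof -
    have "cmod z * sin (Arg z - \<gamma>) = Im (z * cis (- \<gamma>))"
      by (subst (3) rcis_cmod_Arg[symmetric]) (simp add: rcis_def cis_mult mult.assoc)
    also have "\<dots> = Im (\<Sum>k<r. complex_of_real (c k) * cis (p k - \<gamma>))"
      unfolding z(1) by (simp add: sum_distrib_right mult.assoc cis_mult)
    also have "\<dots> = (\<Sum>k<r. c k * sin (p k - \<gamma>))" by simp
    finally show ?thesis .
  qed
  have "(\<Sum>k<r. c k * sin (p k - \<alpha>)) \<le> 0"
  proof (rule sum_nonpos)
    fix k assume "k \<in> {..<r}"
    then have k: "k < r" by simp
    have "sin (\<alpha> - p k) \<ge> 0" using p[OF k] bounds by (intro sin_ge_zero) auto
    moreover have "sin (p k - \<alpha>) = - sin (\<alpha> - p k)" by (metis minus_diff_eq sin_minus)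
    ultimately show "c k * sin (p k - \<alpha>) \<le> 0" using c[OF k] by simp
  qed
  moreover have "sin (Arg z - \<alpha>) > 0" if "Arg z > \<alpha>"
    using that arg bounds by (intro sin_gt_zero) auto
  ultimately have "Arg z \<le> \<alpha>"
    using \<open>z \<noteq> 0\<close> by (force simp flip: rot simp: mult_le_0_iff)
  have "(\<Sum>k<r. c k * sin (p k - \<beta>)) \<ge> 0"
    using p bounds c by (intro sum_nonneg mult_nonneg_nonneg sin_ge_zero) force+
  moreover have "sin (Arg z - \<beta>) < 0" if "Arg z < \<beta>"
    using sin_gt_zero[of "\<beta> - Arg z"] sin_minus[of "\<beta> - Arg z"] that arg bounds by auto
  ultimately have "\<beta> \<le> Arg z"
    using \<open>z \<noteq> 0\<close> by (force simp flip: rot simp: zero_le_mult_iff)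
  then show ?thesis using \<open>Arg z \<le> \<alpha>\<close> by blast
qed

text \<open>\<open>U\<close> reduces the form to the corner block, and \<open>T\<close> turns it
  into a sum of the \<open>cis (ps ! k)\<close> with squared moduli as weights. Values of the form
  thus lie in the cone generated by these unit complex numbers, and unit vectors pulled back through
  \<open>T\<close> and \<open>U\<close> reach each generator.\<close>

lemma angular_numerical_range_quasi_sectorial:
  assumes qs: "quasi_sectorial_phases C ps"
  shows "k < length ps \<Longrightarrow> cis (ps ! k) \<in> angular_numerical_range C"
    and "z \<in> angular_numerical_range C \<Longrightarrow>
      \<exists>c. (\<forall>k. c k \<ge> 0) \<and> z = (\<Sum>k<length ps. complex_of_real (c k) * cis (ps ! k))"
proof -
  define n where "n = dim_row C"
  obtain d r U Cs where n: "d + r = n" and U: "U \<in> carrier_mat n n" "U * mat_adjoint U = 1\<^sub>m n"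
    and Cs: "Cs \<in> carrier_mat r r"
    and C: "C = U * four_block_mat (0\<^sub>m d d) (0\<^sub>m d r) (0\<^sub>m r d) Cs * mat_adjoint U"
    and ps: "sectorial_phases Cs ps"
    using qs unfolding quasi_sectorial_phases_def n_def by blast
  define N where "N = four_block_mat (0\<^sub>m d d) (0\<^sub>m d r) (0\<^sub>m r d) Cs"
  have N: "N \<in> carrier_mat n n"
    unfolding N_def n[symmetric] using Cs by (intro four_block_carrier_mat) auto
  have UU: "mat_adjoint U * U = 1\<^sub>m n"
    using mat_mult_left_right_inverse[of U n "mat_adjoint U"] U by auto
  from ps obtain T where len: "length ps = r" and T: "congruent_via T Cs (cis_diag ps)"
    using Cs unfolding sectorial_phases_def by auto
  then have Tc: "T \<in> carrier_mat r r" and Cs_T: "Cs = mat_adjoint T * cis_diag ps * T"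
    and "invertible_mat T"
    using Cs by (auto simp: congruent_via_def)
  then obtain S where TS: "T * S = 1\<^sub>m r" "S * T = 1\<^sub>m (dim_row S)"
    unfolding invertible_mat_def inverts_mat_def by auto
  have Sc: "S \<in> carrier_mat r r"
    using TS Tc by (metis carrier_matI carrier_matD index_mult_mat(2,3) index_one_mat(2,3))
  have D: "cis_diag ps \<in> carrier_mat r r" by (simp add: cis_diag_def len)
  have form: "(C *\<^sub>v x) \<bullet>c x = (N *\<^sub>v (mat_adjoint U *\<^sub>v x)) \<bullet>c (mat_adjoint U *\<^sub>v x)"
    if "x \<in> carrier_vec n" for x
    using congruence_quadratic_form[of "mat_adjoint U" n n N x] that U N by (simp add: C N_def)
  have corner: "(N *\<^sub>v (a @\<^sub>v b)) \<bullet>c (a @\<^sub>v b) =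
      (\<Sum>k<r. cis (ps ! k) * complex_of_real ((cmod ((T *\<^sub>v b) $ k))\<^sup>2))"
    if a: "a \<in> carrier_vec d" and b: "b \<in> carrier_vec r" for a b
  proof -
    have "(N *\<^sub>v (a @\<^sub>v b)) \<bullet>c (a @\<^sub>v b) = (Cs *\<^sub>v b) \<bullet>c b"
      unfolding N_def by (rule quadratic_form_corner[OF Cs a b])
    also have "\<dots> = (cis_diag ps *\<^sub>v (T *\<^sub>v b)) \<bullet>c (T *\<^sub>v b)"
      unfolding Cs_T by (rule congruence_quadratic_form[OF Tc D b])
    also have "\<dots> = (\<Sum>k<r. cis (ps ! k) * complex_of_real ((cmod ((T *\<^sub>v b) $ k))\<^sup>2))"
      unfolding cis_diag_def len by (rule quadratic_form_mat_diag) (rule mult_mat_vec_carrier[OF Tc b])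
    finally show ?thesis .
  qed
  show "cis (ps ! k) \<in> angular_numerical_range C" if k: "k < length ps"
  proof -
    \<comment> \<open>The preimage of the unit vector under \<open>T\<close>; padded with zeros and
      moved by \<open>U\<close> it becomes the vector at which the form equals
      \<open>cis (ps ! k)\<close>.\<close>
    define b where "b = S *\<^sub>v unit_vec r k"
    have b: "b \<in> carrier_vec r" using Sc by (auto simp: b_def)
    have Tb: "T *\<^sub>v b = unit_vec r k"
      unfolding b_def using TS Sc Tc by (intro mat_vec_cancel_left_inverse[of _ _ r]) auto
    define y where "y = 0\<^sub>v d @\<^sub>v b"
    have y: "y \<in> carrier_vec n" using b by (auto simp: y_def simp flip: n)
    define x where "x = U *\<^sub>v y"
    have x: "x \<in> carrier_vec n" using U y by (auto simp: x_def)
    have "mat_adjoint U *\<^sub>v x = y"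
      unfolding x_def using UU U y by (intro mat_vec_cancel_left_inverse[of _ _ n]) auto
    then have "(C *\<^sub>v x) \<bullet>c x = (\<Sum>i<r. cis (ps ! i) * complex_of_real ((cmod (unit_vec r k $ i))\<^sup>2))"
      using form[OF x] corner[of "0\<^sub>v d" b] b by (simp add: y_def Tb)
    also have "\<dots> = (\<Sum>i<r. if i = k then cis (ps ! i) else 0)"
      using k len by (intro sum.cong) auto
    also have "\<dots> = cis (ps ! k)" using k len by simp
    finally have 1: "(C *\<^sub>v x) \<bullet>c x = cis (ps ! k)" .
    moreover have "x \<noteq> 0\<^sub>v n"
    proof
      assume "x = 0\<^sub>v n"
      then have "(C *\<^sub>v x) \<bullet>c x = 0" using n_def by (auto intro!: scalar_prod_right_zero carrier_vecI)
      with 1 show False by simp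
    qed
    ultimately show ?thesis
      unfolding angular_numerical_range_def n_def[symmetric] using x by (auto intro!: exI[of _ x])
  qed
  show "\<exists>c. (\<forall>k. c k \<ge> 0) \<and> z = (\<Sum>k<length ps. complex_of_real (c k) * cis (ps ! k))"
    if z: "z \<in> angular_numerical_range C"
  proof -
    obtain x where x: "x \<in> carrier_vec n" "z = (C *\<^sub>v x) \<bullet>c x"
      using z unfolding angular_numerical_range_def n_def by auto
    define y where "y = mat_adjoint U *\<^sub>v x"
    have y: "y \<in> carrier_vec (d + r)"
      using mult_mat_vec_carrier[OF mat_adjoint_carrier[OF U(1)] x(1)] unfolding y_def n .
    then have "z = (\<Sum>k<r. cis (ps ! k) * complex_of_real ((cmod ((T *\<^sub>v vec_last y r) $ k))\<^sup>2))"
      using form[OF x(1)] corner[of "vec_first y d" "vec_last y r"] x(2) by (simp add: y_def)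
    then show ?thesis
      by (intro exI[of _ "\<lambda>k. (cmod ((T *\<^sub>v vec_last y r) $ k))\<^sup>2"]) (simp add: len mult.commute)
  qed
qed

text \<open>For every admissible list, this locates the extreme phases by data of the angular
  numerical range alone: they are attained as arguments there and bound all other arguments.\<close>

lemma quasi_sectorial_phases_bounds:
  assumes qs: "quasi_sectorial_phases C ps" and "ps \<noteq> []"
    and rhp: "\<And>z. z \<in> angular_numerical_range C \<Longrightarrow> z = 0 \<or> Re z > 0"
  shows "Max (set ps) \<in> Arg ` (angular_numerical_range C - {0})"
    and "Min (set ps) \<in> Arg ` (angular_numerical_range C - {0})"
    and "\<And>z. z \<in> angular_numerical_range C - {0} \<Longrightarrow> Min (set ps) \<le> Arg z \<and> Arg z \<le> Max (set ps)"
    and "- (pi / 2) < Min (set ps)" "Max (set ps) < pi / 2"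
proof -
  define \<alpha> \<beta> where "\<alpha> = hd ps" and "\<beta> = last ps"
  from qs have sorted: "sorted_wrt (\<ge>) ps"
    and center: "\<alpha> - \<beta> < pi" "(\<alpha> + \<beta>) / 2 \<in> {-pi<..pi}"
    using \<open>ps \<noteq> []\<close> by (auto simp: quasi_sectorial_phases_def sectorial_phases_def \<alpha>_def \<beta>_def)
  have nth: "\<alpha> = ps ! 0" "\<beta> = ps ! (length ps - 1)"
    using \<open>ps \<noteq> []\<close> by (simp_all add: \<alpha>_def \<beta>_def hd_conv_nth last_conv_nth)
  have mono: "ps ! j \<le> ps ! i" if "i \<le> j" "j < length ps" for i j
    using sorted that by (cases "i = j") (auto simp: sorted_wrt_iff_nth_less)
  have between: "\<beta> \<le> ps ! k \<and> ps ! k \<le> \<alpha>" if "k < length ps" for k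
    unfolding nth using that by (auto intro!: mono)
  have mem: "\<alpha> \<in> set ps" "\<beta> \<in> set ps" using \<open>ps \<noteq> []\<close> by (auto simp: \<alpha>_def \<beta>_def)
  have Max: "Max (set ps) = \<alpha>" and Min: "Min (set ps) = \<beta>"
    using mem between by (auto intro!: Max_eqI Min_eqI simp: in_set_conv_nth)
  have cis_mem: "cis p \<in> angular_numerical_range C - {0}" if "p \<in> set ps" for p
    using that angular_numerical_range_quasi_sectorial(1)[OF qs] by (auto simp: in_set_conv_nth)
  have cos: "cos p > 0" if "p \<in> set ps" for p
    using cis_mem[OF that] rhp[of "cis p"] by auto
  \<comment> \<open>The half-plane only tells that the cosines of the phases are positive, which
    leaves multiples of 2\<pi> open. The sum formula for \<open>cos \<alpha> + cos \<beta>\<close>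
    transfers positivity to the center \<open>m\<close>; its principal value then lies within
    \<open>pi / 2\<close> of 0, which rules the multiples out.\<close>
  define m \<delta> where "m = (\<alpha> + \<beta>) / 2" and "\<delta> = (\<alpha> - \<beta>) / 2"
  have \<delta>: "0 \<le> \<delta>" "\<delta> < pi / 2" using center(1) between[of 0] \<open>ps \<noteq> []\<close> by (auto simp: \<delta>_def)
  have \<alpha>: "\<alpha> = m + \<delta>" and \<beta>: "\<beta> = m - \<delta>" by (simp_all add: m_def \<delta>_def field_simps)
  have "cos \<alpha> + cos \<beta> = 2 * cos m * cos \<delta>" by (simp add: \<alpha> \<beta> cos_add cos_diff)
  moreover have "cos \<delta> > 0" using \<delta> by (intro cos_gt_zero_pi) auto
  moreover have "cos \<alpha> + cos \<beta> > 0" using cos mem by (simp add: add_pos_pos)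
  ultimately have "cos m > 0" by (simp add: zero_less_mult_iff)
  then have "\<bar>m\<bar> < pi / 2" using center(2) by (intro abs_less_pi_half_if_cos_pos) (auto simp: m_def)
  then have "\<bar>\<alpha>\<bar> \<le> pi" "\<bar>\<beta>\<bar> \<le> pi" using \<delta> by (auto simp: \<alpha> \<beta>)
  then have bounds: "\<bar>\<alpha>\<bar> < pi / 2" "\<bar>\<beta>\<bar> < pi / 2"
    using cos mem abs_less_pi_half_if_cos_pos by blast+
  then have Arg: "Arg (cis \<alpha>) = \<alpha>" "Arg (cis \<beta>) = \<beta>"
    using pi_gt_zero by (auto intro!: cis_Arg_unique simp: sgn_eq)
  show "Max (set ps) \<in> Arg ` (angular_numerical_range C - {0})"
    "Min (set ps) \<in> Arg ` (angular_numerical_range C - {0})"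
    unfolding Max Min using Arg cis_mem mem by (metis image_eqI)+
  show "- (pi / 2) < Min (set ps)" "Max (set ps) < pi / 2"
    unfolding Max Min using bounds by auto
  show "Min (set ps) \<le> Arg z \<and> Arg z \<le> Max (set ps)" if z: "z \<in> angular_numerical_range C - {0}" for z
  proof -
    obtain c where "\<And>k. c k \<ge> 0" "z = (\<Sum>k<length ps. complex_of_real (c k) * cis (ps ! k))"
      using angular_numerical_range_quasi_sectorial(2)[OF qs] z by blast
    moreover have "Re z > 0" using rhp[of z] z by blast
    moreover have "- (pi / 2) < \<beta>" "\<beta> \<le> \<alpha>" "\<alpha> < pi / 2"
      using bounds \<delta>(1) by (auto simp: \<delta>_def abs_less_iff)
    ultimately show ?thesis
      unfolding Max Min using between
      by (intro Arg_cone_bounds[where r = "length ps" and c = c and p = "\<lambda>k. ps ! k"])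
  qed
qed

section \<open>Phases of quasi-accretive matrices\<close>

lemma quasi_accretive_angular_numerical_range:
  assumes "quasi_accretive n C" "z \<in> angular_numerical_range C"
  shows "z = 0 \<or> Re z > 0"
proof -
  have C: "C \<in> carrier_mat n n" using assms by (simp add: quasi_accretive_def)
  obtain x where x: "x \<in> carrier_vec n" "z = (C *\<^sub>v x) \<bullet>c x"
    using assms(2) C by (auto simp: angular_numerical_range_def)
  show ?thesis
  proof (cases "Re z = 0")
    case True
    then have "C *\<^sub>v x = 0\<^sub>v n" using assms(1) x by (simp add: quasi_accretive_def)
    then show ?thesis using x by simp
  next
    case False
    then show ?thesis using assms(1) x by (auto simp: quasi_accretive_def order_less_le)
  qed
qed

text \<open>The zero matrix has infinite extreme phases by convention, so this case must also be
  visible in the range. A vanishing form at a unit vector puts that vector into the kernel, and so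
  every column vanishes.\<close>

lemma quasi_accretive_zero_iff:
  assumes "quasi_accretive n C"
  shows "C = 0\<^sub>m n n \<longleftrightarrow> angular_numerical_range C \<subseteq> {0}"
proof
  assume "C = 0\<^sub>m n n"
  moreover have "0\<^sub>m n n *\<^sub>v x = 0\<^sub>v n" if "x \<in> carrier_vec n" for x :: "complex vec"
    using that by (intro eq_vecI) auto
  ultimately show "angular_numerical_range C \<subseteq> {0}"
    by (auto simp: angular_numerical_range_def)
next
  have C: "C \<in> carrier_mat n n" using assms by (simp add: quasi_accretive_def)
  assume sub: "angular_numerical_range C \<subseteq> {0}"
  have "C *\<^sub>v unit_vec n j = 0\<^sub>v n" if j: "j < n" for j
  proof -
    have "(C *\<^sub>v unit_vec n j) \<bullet>c unit_vec n j \<in> angular_numerical_range C"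
      unfolding angular_numerical_range_def using C j by (intro CollectI exI[of _ "unit_vec n j"]) auto
    then have "(C *\<^sub>v unit_vec n j) \<bullet>c unit_vec n j = 0" using sub by blast
    then show ?thesis using assms by (simp add: quasi_accretive_def)
  qed
  then have "col C j $ i = 0" if "i < n" "j < n" for i j
    using that by (simp flip: mult_unit_vec[OF C])
  then show "C = 0\<^sub>m n n" using C by (intro eq_matI) auto
qed

lemma quasi_sectorial_phases_nonempty:
  assumes qs: "quasi_sectorial_phases C ps" and "angular_numerical_range C - {0} \<noteq> {}"
  shows "ps \<noteq> []"
  using assms(2) angular_numerical_range_quasi_sectorial(2)[OF qs] by fastforce

text \<open>A line would contain some nonzero number and its negative, which the open half-plane
  forbids. The arguments of nonzero elements lie between the extreme phases, and that interval is
  shorter than \<pi>.\<close>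

lemma quasi_accretive_quasi_sectorial:
  assumes qa: "quasi_accretive n C"
  shows "quasi_sectorial C"
proof -
  let ?K = "angular_numerical_range C"
  note rhp = quasi_accretive_angular_numerical_range[OF qa]
  obtain ps where qs: "quasi_sectorial_phases C ps" using quasi_accretive_phases[OF qa] by blast
  have "\<not> l \<subseteq> ?K" if l: "line_through_origin l" for l
  proof
    assume sub: "l \<subseteq> ?K"
    obtain z where z: "z \<noteq> 0" "l = range (\<lambda>t::real. complex_of_real t * z)"
      using l by (auto simp: line_through_origin_def)
    have "complex_of_real 1 * z \<in> l" "complex_of_real (- 1) * z \<in> l" unfolding z(2) by blast+
    then have "z \<in> ?K" "- z \<in> ?K" using sub by auto
    then show False using rhp[of z] rhp[of "- z"] z(1) by auto
  qed
  then have field: "field_angle C = subtended_angle ?K" by (auto simp: field_angle_def Let_def)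
  have "subtended_angle ?K < pi"
  proof (cases "?K - {0} = {}")
    case True
    then have "insert 0 {\<bar>Arg (z / y)\<bar> | y z. y \<in> ?K - {0} \<and> z \<in> ?K - {0}} = {0}" by blast
    then show ?thesis by (simp only: subtended_angle_def cSup_singleton pi_gt_zero)
  next
    case False
    then have "ps \<noteq> []" by (rule quasi_sectorial_phases_nonempty[OF qs])
    note b = quasi_sectorial_phases_bounds[OF qs this rhp]
    define w where "w = Max (set ps) - Min (set ps)"
    have w: "0 \<le> w" "w < pi"
      using b(4,5) Min_le[of "set ps" "Max (set ps)"] \<open>ps \<noteq> []\<close> by (simp_all del: Max_less_iff Min_gr_iff add: w_def)
    have "\<bar>Arg (z / y)\<bar> \<le> w" if "y \<in> ?K - {0}" "z \<in> ?K - {0}" for y z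
    proof -
      have yz: "Min (set ps) \<le> Arg y" "Arg y \<le> Max (set ps)" "Min (set ps) \<le> Arg z" "Arg z \<le> Max (set ps)"
        "y \<noteq> 0" "z \<noteq> 0"
        using b(3) that by auto
      \<comment> \<open>The difference has modulus at most \<open>w < pi\<close>, so it is already
        the principal argument.\<close>
      then have "Arg (z / y) = Arg z - Arg y"
        using w by (intro cis_Arg_unique) (auto simp: w_def sgn_divide cis_Arg[symmetric] cis_divide)
      then show ?thesis using yz by (auto simp: w_def)
    qed
    then have "subtended_angle ?K \<le> w"
      unfolding subtended_angle_def using w by (intro cSup_least) auto
    then show ?thesis using w by simp
  qed
  then show ?thesis by (simp add: quasi_sectorial_def field)
qed

lemma quasi_accretive_phases_list:
  assumes "quasi_accretive n C"
  shows "quasi_sectorial_phases C (phases C)"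
  using quasi_accretive_phases[OF assms] quasi_accretive_quasi_sectorial[OF assms]
  unfolding phases_def is_phases_def by (simp add: someI_ex)

text \<open>Each extreme phase of one matrix is an argument attained on the common range, hence
  bounded by the extreme phases of the other; symmetry gives equality.\<close>

lemma phase_extremes_cong:
  assumes C: "quasi_accretive n C" and C': "quasi_accretive n C'"
    and K: "angular_numerical_range C = angular_numerical_range C'"
  shows "phase_max C = phase_max C' \<and> phase_min C = phase_min C'"
proof (cases "C = 0\<^sub>m n n")
  case True
  then have "C' = 0\<^sub>m n n"
    using quasi_accretive_zero_iff[OF C] quasi_accretive_zero_iff[OF C'] K by simp
  with True show ?thesis by simp
next
  case False
  then have ne: "C \<noteq> 0\<^sub>m n n" "C' \<noteq> 0\<^sub>m n n"
    and K0: "angular_numerical_range C - {0} \<noteq> {}" "angular_numerical_range C' - {0} \<noteq> {}"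
    using quasi_accretive_zero_iff[OF C] quasi_accretive_zero_iff[OF C'] K by auto
  have dim: "dim_row C = n" "dim_col C = n" "dim_row C' = n" "dim_col C' = n"
    using C C' by (auto simp: quasi_accretive_def)
  note ps = quasi_accretive_phases_list[OF C] quasi_accretive_phases_list[OF C']
  note b = quasi_sectorial_phases_bounds[OF ps(1) quasi_sectorial_phases_nonempty[OF ps(1) K0(1)]
      quasi_accretive_angular_numerical_range[OF C]]
  note b' = quasi_sectorial_phases_bounds[OF ps(2) quasi_sectorial_phases_nonempty[OF ps(2) K0(2)]
      quasi_accretive_angular_numerical_range[OF C']]
  have "Max (set (phases C)) = Max (set (phases C'))"
    using b(1) b'(1) b(3) b'(3) unfolding K by (force intro: antisym)
  moreover have "Min (set (phases C)) = Min (set (phases C'))"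
    using b(2) b'(2) b(3) b'(3) unfolding K by (force intro: antisym)
  ultimately show ?thesis using ne by (simp add: phase_max_def phase_min_def dim)
qed

text \<open>Otherwise, with \<open>y = C\<^sup>* x \<noteq> 0\<close>, the quadratic form of \<open>C\<close> at \<open>t x + y\<close> is a nonconstant affine
  function of the conjugate of \<open>t\<close>, so the angular numerical range is the whole plane.\<close>

lemma semi_sectorial_kernel:
  assumes C: "C \<in> carrier_mat n n" and x: "x \<in> carrier_vec n" "C *\<^sub>v x = 0\<^sub>v n"
    and semi: "semi_sectorial C"
  shows "mat_adjoint C *\<^sub>v x = 0\<^sub>v n"
proof (rule ccontr)
  define y where "y = mat_adjoint C *\<^sub>v x"
  assume "mat_adjoint C *\<^sub>v x \<noteq> 0\<^sub>v n"
  moreover have y: "y \<in> carrier_vec n"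
    unfolding y_def using mult_mat_vec_carrier[OF mat_adjoint_carrier[OF C] x(1)] .
  ultimately have s0: "y \<bullet>c y \<noteq> 0" by (simp add: y_def)
  have Cy: "C *\<^sub>v y \<in> carrier_vec n" using C y by (rule mult_mat_vec_carrier)
  have "y \<bullet>c y = x \<bullet>c (C *\<^sub>v y)"
    using adjoint_cscalar_prod[OF C x(1) y] by (simp add: y_def)
  also have "\<dots> = cnj ((C *\<^sub>v y) \<bullet>c x)"
    unfolding cscalar_prod_sum[OF x(1) Cy] cscalar_prod_sum[OF Cy x(1)] by (simp add: mult.commute)
  finally have s: "y \<bullet>c y = cnj ((C *\<^sub>v y) \<bullet>c x)" .
  have "u \<in> angular_numerical_range C" for u
  proof -
    \<comment> \<open>Solves \<open>cnj t * ((C *\<^sub>v y) \<bullet>c x) + (C *\<^sub>v y)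
      \<bullet>c y = u\<close>. The coefficient of \<open>cnj t\<close> is the conjugate of
      \<open>y \<bullet>c y\<close>, hence nonzero.\<close>
    define t where "t = cnj ((u - (C *\<^sub>v y) \<bullet>c y) / ((C *\<^sub>v y) \<bullet>c x))"
    define z where "z = t \<cdot>\<^sub>v x + y"
    have z: "z \<in> carrier_vec n" using x y by (simp add: z_def)
    have "t \<cdot>\<^sub>v 0\<^sub>v n = 0\<^sub>v n" by (intro eq_vecI) auto
    then have Cz: "C *\<^sub>v z = C *\<^sub>v y"
      using C x y Cy by (simp add: z_def mult_add_distrib_mat_vec[of _ n n] mult_mat_vec[of _ n n])
    have "(C *\<^sub>v z) \<bullet>c z = (\<Sum>i<n. (C *\<^sub>v y) $ i * cnj (t * x $ i + y $ i))"
      unfolding Cz cscalar_prod_sum[OF Cy z] using x y by (simp add: z_def)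
    also have "\<dots> = cnj t * ((C *\<^sub>v y) \<bullet>c x) + (C *\<^sub>v y) \<bullet>c y"
      unfolding cscalar_prod_sum[OF Cy x(1)] cscalar_prod_sum[OF Cy y]
      by (simp add: sum_distrib_left sum.distrib algebra_simps)
    also have "\<dots> = u" using s s0 by (simp add: t_def)
    finally have "(C *\<^sub>v z) \<bullet>c z = u" .
    moreover have "z \<noteq> 0\<^sub>v n"
    proof
      assume "z = 0\<^sub>v n"
      moreover have "C *\<^sub>v 0\<^sub>v n = 0\<^sub>v n" using C by (intro eq_vecI) auto
      ultimately have "C *\<^sub>v y = 0\<^sub>v n" using Cz by simp
      then show False using s s0 x(1) by simp
    qed
    ultimately show ?thesis
      unfolding angular_numerical_range_def using z C by (intro CollectI exI[of _ z]) auto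
  qed
  then have K: "angular_numerical_range C = UNIV" by blast
  have lines: "line_through_origin (range (\<lambda>t::real. complex_of_real t * z))" if "z \<noteq> 0" for z
    using that by (auto simp: line_through_origin_def)
  \<comment> \<open>The real and the imaginary axis are two different lines in the plane, so the
    definition of the field angle falls through to \<open>2 * pi\<close>.\<close>
  have "\<i> \<in> range (\<lambda>t::real. complex_of_real t * \<i>)" by (intro image_eqI[of _ _ 1]) auto
  moreover have "\<i> \<notin> range (\<lambda>t::real. complex_of_real t * 1)" by (auto simp: complex_eq_iff)
  ultimately have "range (\<lambda>t::real. complex_of_real t * 1) \<noteq> range (\<lambda>t::real. complex_of_real t * \<i>)"
    by metis
  then have "\<not> (\<exists>!l. line_through_origin l)" "\<exists>l. line_through_origin l"
    using lines[OF one_neq_zero] lines[OF complex_i_not_zero] by blast+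
  then have "field_angle C = 2 * pi" by (auto simp: field_angle_def K Let_def)
  then show False using semi by (simp add: semi_sectorial_def)
qed

text \<open>\<open>similarity\<close> takes its inverse from the option-valued
  \<open>mat_inverse\<close>. The value is identified by uniqueness of inverses, and
  \<open>None\<close> is excluded by exhibiting one.\<close>

lemma mat_inverse_mat_diag:
  fixes f :: "nat \<Rightarrow> complex"
  assumes "\<And>i. i < n \<Longrightarrow> f i \<noteq> 0"
  shows "mat_inverse (mat_diag n f) = Some (mat_diag n (\<lambda>i. inverse (f i)))"
proof -
  let ?D = "mat_diag n f" and ?E = "mat_diag n (\<lambda>i. inverse (f i))"
  have inv: "?E * ?D = 1\<^sub>m n" "?D * ?E = 1\<^sub>m n"
    using assms mat_diag_cong[of n "\<lambda>i. inverse (f i) * f i" "\<lambda>_. 1"]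
      mat_diag_cong[of n "\<lambda>i. f i * inverse (f i)" "\<lambda>_. 1"] by simp_all
  show ?thesis
  proof (cases "mat_inverse ?D")
    case None
    then have "?D \<notin> Units (ring_mat TYPE(complex) n ())"
      by (rule mat_inverse(1)[OF mat_diag_dim])
    moreover have "?D \<in> Units (ring_mat TYPE(complex) n ())"
      using inv by (auto simp: Units_def ring_mat_def intro!: bexI[of _ ?E])
    ultimately show ?thesis by contradiction
  next
    case (Some B)
    then have B: "?D * B = 1\<^sub>m n" "B \<in> carrier_mat n n"
      using mat_inverse(2)[OF mat_diag_dim] by auto
    have "B = (?E * ?D) * B" using B inv by simp
    also have "\<dots> = ?E * (?D * B)" using B by (intro assoc_mult_mat[of _ n n _ n _ n]) auto
    also have "\<dots> = ?E" unfolding B(1) by (rule right_mult_one_mat[OF mat_diag_dim])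
    finally show ?thesis using Some by simp
  qed
qed

lemma similarity_mat_diag:
  assumes "C \<in> carrier_mat n n" "\<And>i. i < n \<Longrightarrow> f i \<noteq> 0"
  shows "similarity (mat_diag n f) C = mat n n (\<lambda>(i, j). C $$ (i, j) * f j / f i)"
proof -
  have "mat_diag n (\<lambda>i. inverse (f i)) * C = mat n n (\<lambda>(i, j). inverse (f i) * C $$ (i, j))"
    using assms(1) by (rule mat_diag_mult_left)
  then have "similarity (mat_diag n f) C = mat n n (\<lambda>(i, j). inverse (f i) * C $$ (i, j)) * mat_diag n f"
    using assms(2) by (simp add: similarity_def mat_inverse_mat_diag)
  also have "\<dots> = mat n n (\<lambda>(i, j). mat n n (\<lambda>(i, j). inverse (f i) * C $$ (i, j)) $$ (i, j) * f j)"
    by (rule mat_diag_mult_right) simp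
  also have "\<dots> = mat n n (\<lambda>(i, j). C $$ (i, j) * f j / f i)"
    by (rule eq_matI) (auto simp: field_simps)
  finally show ?thesis .
qed

section \<open>Balanced Laplacians\<close>

text \<open>Expand the squared modulus of \<open>x i - x j\<close>: the terms in a single index are
  killed by the row and column sums, and only the mixed term \<open>2 * Re (x j * cnj (x i))\<close>
  survives.\<close>

lemma quadratic_form_zero_line_sums:
  fixes m :: "nat \<Rightarrow> nat \<Rightarrow> real" and x :: "nat \<Rightarrow> complex"
  assumes rows: "\<And>i. i < n \<Longrightarrow> (\<Sum>j<n. m i j) = 0"
    and cols: "\<And>j. j < n \<Longrightarrow> (\<Sum>i<n. m i j) = 0"
  shows "Re (\<Sum>i<n. \<Sum>j<n. complex_of_real (m i j) * x j * cnj (x i)) =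
    (\<Sum>i<n. \<Sum>j<n. - m i j * (cmod (x i - x j))\<^sup>2) / 2"
proof -
  have 1: "(\<Sum>i<n. \<Sum>j<n. m i j * (cmod (x i))\<^sup>2) = 0"
    using rows by (simp flip: sum_distrib_right)
  have "(\<Sum>i<n. \<Sum>j<n. m i j * (cmod (x j))\<^sup>2) = (\<Sum>j<n. \<Sum>i<n. m i j * (cmod (x j))\<^sup>2)"
    by (rule sum.swap)
  also have "\<dots> = 0" using cols by (simp flip: sum_distrib_right)
  finally have 2: "(\<Sum>i<n. \<Sum>j<n. m i j * (cmod (x j))\<^sup>2) = 0" .
  have "- m i j * (cmod (x i - x j))\<^sup>2 =
      2 * Re (complex_of_real (m i j) * x j * cnj (x i)) - m i j * (cmod (x i))\<^sup>2 - m i j * (cmod (x j))\<^sup>2" for i j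
    unfolding cmod_power2 by (simp add: power2_eq_square algebra_simps)
  then have "(\<Sum>i<n. \<Sum>j<n. - m i j * (cmod (x i - x j))\<^sup>2) =
      2 * (\<Sum>i<n. \<Sum>j<n. Re (complex_of_real (m i j) * x j * cnj (x i)))"
    by (simp add: sum_subtractf 1 2 flip: sum_distrib_left)
  then show ?thesis by simp
qed

text \<open>Balance refers to the reweighted graph whose Laplacian is \<open>V * L\<close>, with
  entries \<open>m i j\<close> below: \<open>left_kernel\<close> makes its columns sum to zero as
  well as its rows.\<close>

locale balanced_laplacian =
  fixes n :: nat and G :: "nat pair_pre_digraph" and w :: "nat \<times> nat \<Rightarrow> real" and v :: "real vec"
  assumes verts: "pverts G = {..<n}"
    and weights: "\<forall>e\<in>parcs G. w e > 0"
    and connected: "strongly_connected (with_proj G)"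
    and v: "v \<in> carrier_vec n" "\<forall>i<n. v $ i > 0"
    and left_kernel: "transpose_mat (laplacian n G w) *\<^sub>v v = 0\<^sub>v n"
begin

abbreviation "l i j \<equiv> laplacian n G w $$ (i, j)"

definition m :: "nat \<Rightarrow> nat \<Rightarrow> real" where "m i j = v $ i * l i j"

text \<open>The quadratic form of \<open>V * L\<close>, taken on functions so that a diagonal
  congruence becomes a substitution in the argument.\<close>

definition form :: "(nat \<Rightarrow> complex) \<Rightarrow> complex" where
  "form x = (\<Sum>i<n. \<Sum>j<n. complex_of_real (m i j) * x j * cnj (x i))"

section \<open>Line sums, signs and null vectors of the form\<close>

lemma laplacian_carrier: "laplacian n G w \<in> carrier_mat n n"
  by (simp add: laplacian_def)

lemma laplacian_row_sum:
  assumes "i < n"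
  shows "(\<Sum>j<n. l i j) = 0"
proof -
  have "(\<Sum>j<n. l i j) = l i i + (\<Sum>j\<in>{..<n} - {i}. l i j)"
    using assms by (intro sum.remove) auto
  also have "(\<Sum>j\<in>{..<n} - {i}. l i j) = - (\<Sum>j\<in>{..<n} - {i}. adjacency G w i j)"
    unfolding sum_negf[symmetric] using assms by (intro sum.cong) (auto simp: laplacian_def)
  finally show ?thesis using assms by (simp add: laplacian_def)
qed

lemma m_row_sum: "i < n \<Longrightarrow> (\<Sum>j<n. m i j) = 0"
  by (simp add: m_def laplacian_row_sum flip: sum_distrib_left)

lemma m_col_sum:
  assumes j: "j < n"
  shows "(\<Sum>i<n. m i j) = 0"
proof -
  have "(transpose_mat (laplacian n G w) *\<^sub>v v) $ j = (\<Sum>i<n. m i j)"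
    using j v laplacian_carrier
    by (auto simp: m_def scalar_prod_def lessThan_atLeast0 mult.commute intro!: sum.cong)
  then show ?thesis using left_kernel j by simp
qed

lemma m_nonpos: "i < n \<Longrightarrow> j < n \<Longrightarrow> i \<noteq> j \<Longrightarrow> m i j \<le> 0"
  using v weights by (auto simp: m_def laplacian_def adjacency_def mult_le_0_iff less_imp_le)

lemma m_neg: "i < n \<Longrightarrow> j < n \<Longrightarrow> i \<noteq> j \<Longrightarrow> (j, i) \<in> parcs G \<Longrightarrow> m i j < 0"
  using v weights by (auto simp: m_def laplacian_def adjacency_def mult_less_0_iff)

lemma Re_form: "Re (form x) = (\<Sum>i<n. \<Sum>j<n. - m i j * (cmod (x i - x j))\<^sup>2) / 2"
  unfolding form_def by (rule quadratic_form_zero_line_sums[OF m_row_sum m_col_sum])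

lemma form_summand_nonneg: "i < n \<Longrightarrow> j < n \<Longrightarrow> - m i j * (cmod (x i - x j))\<^sup>2 \<ge> 0"
  using m_nonpos[of i j] by (cases "i = j") (auto simp: mult_le_0_iff)

lemma Re_form_nonneg: "Re (form x) \<ge> 0"
  unfolding Re_form by (intro divide_nonneg_pos sum_nonneg form_summand_nonneg) auto

text \<open>A vanishing sum of nonnegative terms has vanishing terms, so \<open>x\<close> takes the
  same value at both ends of every arc. A directed path from \<open>i\<close> to \<open>j\<close>
  carries the equality along.\<close>

lemma form_null_imp_constant:
  assumes 0: "Re (form x) = 0" and ij: "i < n" "j < n"
  shows "x i = x j"
proof -
  have "(\<Sum>i<n. \<Sum>j<n. - m i j * (cmod (x i - x j))\<^sup>2) = 0" using 0 by (simp add: Re_form)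
  then have "\<forall>i\<in>{..<n}. (\<Sum>j<n. - m i j * (cmod (x i - x j))\<^sup>2) = 0"
    by (rule iffD1[OF sum_nonneg_eq_0_iff, rotated 2])
      (rule finite_lessThan sum_nonneg form_summand_nonneg | erule lessThan_iff[THEN iffD1])+
  then have "(\<Sum>j<n. - m i j * (cmod (x i - x j))\<^sup>2) = 0" if "i < n" for i using that by blast
  then have "\<forall>j\<in>{..<n}. - m i j * (cmod (x i - x j))\<^sup>2 = 0" if "i < n" for i
    by (rule iffD1[OF sum_nonneg_eq_0_iff, rotated 2, OF _ finite_lessThan])
      (rule that form_summand_nonneg | erule lessThan_iff[THEN iffD1])+
  then have zero: "- m i j * (cmod (x i - x j))\<^sup>2 = 0" if "i < n" "j < n" for i j
    using that by blast
  \<comment> \<open>The weight of the arc from \<open>a\<close> to \<open>b\<close> sits in row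
    \<open>b\<close>, column \<open>a\<close>, hence the swapped indices.\<close>
  have arc: "x a = x b" if "(a, b) \<in> parcs G" "a < n" "b < n" for a b
    using zero[of b a] m_neg[of b a] that by (cases "a = b") auto
  have "i \<rightarrow>\<^sup>*\<^bsub>with_proj G\<^esub> j"
    using connected ij verts by (auto simp: strongly_connected_def)
  then have "(i, j) \<in> rtrancl_on {..<n} (parcs G)" by (simp add: reachable_def verts)
  then show ?thesis
    by (induction rule: rtrancl_on_induct) (use arc in auto)
qed

text \<open>The matrix \<open>VL\<close> is the case \<open>s = 1\<close>, and \<open>D\<^sub>0\<^sup>-\<^sup>1 L D\<^sub>0\<close> is the case \<open>s = v\<^sup>-\<^sup>1\<^sup>/\<^sup>2\<close>.\<close>

definition scaled :: "(nat \<Rightarrow> real) \<Rightarrow> complex mat" where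
  "scaled s = mat n n (\<lambda>(i, j). complex_of_real (s i * m i j * s j))"

lemma scaled_mult_vec:
  assumes "x \<in> carrier_vec n" "i < n"
  shows "(scaled s *\<^sub>v x) $ i =
    complex_of_real (s i) * (\<Sum>j<n. complex_of_real (m i j) * (complex_of_real (s j) * x $ j))"
  using assms by (auto simp: scaled_def scalar_prod_def lessThan_atLeast0 sum_distrib_left mult_ac intro!: sum.cong)

lemma quadratic_form_scaled:
  assumes x: "x \<in> carrier_vec n"
  shows "(scaled s *\<^sub>v x) \<bullet>c x = form (\<lambda>i. complex_of_real (s i) * x $ i)"
proof -
  have "scaled s *\<^sub>v x \<in> carrier_vec n" by (simp add: scaled_def carrier_vecI)
  then have "(scaled s *\<^sub>v x) \<bullet>c x = (\<Sum>i<n. (scaled s *\<^sub>v x) $ i * cnj (x $ i))"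
    using x by (rule cscalar_prod_sum)
  also have "\<dots> = form (\<lambda>i. complex_of_real (s i) * x $ i)"
    unfolding form_def using x
    by (intro sum.cong refl) (simp add: scaled_mult_vec sum_distrib_left sum_distrib_right mult_ac)
  finally show ?thesis .
qed

lemma quasi_accretive_scaled: "quasi_accretive n (scaled s)"
  unfolding quasi_accretive_def
proof (intro conjI ballI impI)
  show "scaled s \<in> carrier_mat n n" by (simp add: scaled_def)
  fix x :: "complex vec" assume x: "x \<in> carrier_vec n"
  show "0 \<le> Re ((scaled s *\<^sub>v x) \<bullet>c x)"
    unfolding quadratic_form_scaled[OF x] by (rule Re_form_nonneg)
  assume "Re ((scaled s *\<^sub>v x) \<bullet>c x) = 0"
  then have const: "complex_of_real (s i) * x $ i = complex_of_real (s j) * x $ j" if "i < n" "j < n" for i j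
    unfolding quadratic_form_scaled[OF x] by (rule form_null_imp_constant) (use that in auto)
  show "scaled s *\<^sub>v x = 0\<^sub>v n"
  proof (rule eq_vecI)
    fix i assume "i < dim_vec (0\<^sub>v n :: complex vec)"
    then have i: "i < n" by simp
    have "(\<Sum>j<n. complex_of_real (m i j) * (complex_of_real (s j) * x $ j)) =
        (\<Sum>j<n. complex_of_real (m i j) * (complex_of_real (s i) * x $ i))"
      by (intro sum.cong refl arg_cong2[of _ _ _ _ "(*)"] const) (use i in auto)
    also have "\<dots> = complex_of_real (\<Sum>j<n. m i j) * (complex_of_real (s i) * x $ i)"
      by (simp add: sum_distrib_right)
    also have "\<dots> = 0" using m_row_sum[OF i] by simp
    finally show "(scaled s *\<^sub>v x) $ i = 0\<^sub>v n $ i"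
      using i x by (simp add: scaled_mult_vec)
  qed (simp add: scaled_def)
qed

text \<open>The right side does not mention \<open>s\<close>: a positive scaling permutes the
  nonzero arguments of the form. All positive scalings thus share one angular numerical
  range.\<close>

lemma angular_numerical_range_scaled:
  assumes "\<And>i. i < n \<Longrightarrow> s i > 0"
  shows "angular_numerical_range (scaled s) = form ` {y. \<exists>i<n. y i \<noteq> 0}"
proof (intro equalityI subsetI)
  fix u assume "u \<in> angular_numerical_range (scaled s)"
  then obtain x where x: "x \<in> carrier_vec n" "x \<noteq> 0\<^sub>v n" "u = form (\<lambda>i. complex_of_real (s i) * x $ i)"
    by (auto simp: angular_numerical_range_def scaled_def[THEN arg_cong, of dim_row]
      simp flip: quadratic_form_scaled)
  then have "\<exists>i<n. x $ i \<noteq> 0" by (auto intro!: eq_vecI)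
  then show "u \<in> form ` {y. \<exists>i<n. y i \<noteq> 0}"
    unfolding x(3) using assms by (intro imageI CollectI) (metis less_irrefl mult_eq_0_iff of_real_eq_0_iff)
next
  fix u assume "u \<in> form ` {y. \<exists>i<n. y i \<noteq> 0}"
  then obtain y i where y: "u = form y" "i < n" "y i \<noteq> 0" by blast
  define x where "x = vec n (\<lambda>i. y i / complex_of_real (s i))"
  have "x $ i \<noteq> 0" using y assms[of i] by (simp add: x_def)
  then have "x \<noteq> 0\<^sub>v n" using y(2) by auto
  moreover have "form (\<lambda>i. complex_of_real (s i) * x $ i) = u"
    unfolding y(1) form_def using assms
    by (intro sum.cong refl) (force simp: x_def)
  moreover have "x \<in> carrier_vec n" by (simp add: x_def)
  ultimately show "u \<in> angular_numerical_range (scaled s)"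
    unfolding angular_numerical_range_def
    by (intro CollectI exI[of _ x]) (simp add: quadratic_form_scaled, simp add: scaled_def)
qed

text \<open>The positive left null vector obtained from \<open>D\<close> is compared with
  \<open>v\<close> by inserting their entrywise ratio into the form. The value is zero, so the ratio
  is constant.\<close>

lemma similarity_semi_sectorial_eq:
  assumes d: "\<And>i. i < n \<Longrightarrow> d i > 0"
  defines "L \<equiv> map_mat complex_of_real (laplacian n G w)"
  defines "D \<equiv> mat_diag n (\<lambda>i. complex_of_real (d i))"
  assumes semi: "semi_sectorial (similarity D L)"
  shows "similarity D L = scaled (\<lambda>i. 1 / sqrt (v $ i))"
proof -
  have L: "L \<in> carrier_mat n n" using laplacian_carrier by (simp add: L_def)
  have d0: "complex_of_real (d i) \<noteq> 0" if "i < n" for i using d[OF that] by simp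
  have C: "similarity D L = mat n n (\<lambda>(i, j). complex_of_real (l i j * d j / d i))"
    using laplacian_carrier L d0 unfolding D_def
    by (intro eq_matI) (auto simp: similarity_mat_diag L_def)
  \<comment> \<open>This is the inverse of \<open>D\<close> applied to the all-ones vector; it lies
    in the kernel of the similar matrix because the rows of the Laplacian sum to zero.\<close>
  define x where "x = vec n (\<lambda>i. complex_of_real (1 / d i))"
  have x: "x \<in> carrier_vec n" by (simp add: x_def)
  have "similarity D L *\<^sub>v x = 0\<^sub>v n"
  proof (rule eq_vecI)
    fix i assume "i < dim_vec (0\<^sub>v n :: complex vec)"
    then have i: "i < n" by simp
    have "(similarity D L *\<^sub>v x) $ i = (\<Sum>j<n. complex_of_real (l i j * d j / d i) * complex_of_real (1 / d j))"
      unfolding C using i by (auto simp: x_def scalar_prod_def lessThan_atLeast0 intro!: sum.cong)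
    also have "\<dots> = (\<Sum>j<n. complex_of_real (l i j / d i))"
      using d0 by (intro sum.cong) auto
    also have "\<dots> = complex_of_real ((\<Sum>j<n. l i j) / d i)" by (simp add: sum_divide_distrib)
    finally show "(similarity D L *\<^sub>v x) $ i = 0\<^sub>v n $ i" using i by (simp add: laplacian_row_sum)
  qed (simp add: C)
  then have adj: "mat_adjoint (similarity D L) *\<^sub>v x = 0\<^sub>v n"
    using semi by (intro semi_sectorial_kernel[OF _ x]) (auto simp: C)
  have "(mat_adjoint (similarity D L) *\<^sub>v x) $ j =
      (\<Sum>i<n. complex_of_real (l i j * d j / d i) * complex_of_real (1 / d i))" if "j < n" for j
    using that by (auto simp: C x_def scalar_prod_def lessThan_atLeast0 intro!: sum.cong)
  then have "(\<Sum>i<n. complex_of_real (l i j * d j / d i) * complex_of_real (1 / d i)) = 0" if "j < n" for j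
    unfolding adj using that by simp
  then have sum0: "(\<Sum>i<n. l i j * d j / d i * (1 / d i)) = 0" if "j < n" for j
    using that by (simp only: of_real_mult[symmetric] of_real_sum[symmetric] of_real_eq_0_iff)
  have factor: "(\<Sum>i<n. l i j * d j / d i * (1 / d i)) = d j * (\<Sum>i<n. l i j / (d i)\<^sup>2)" for j
    by (simp add: sum_distrib_left power2_eq_square mult_ac)
  have left: "(\<Sum>i<n. l i j / (d i)\<^sup>2) = 0" if "j < n" for j
    using sum0[OF that, unfolded factor] d[OF that] by simp
  \<comment> \<open>The entrywise ratio of the left null vector with entries
    \<open>1 / (d i)\<^sup>2\<close> to \<open>v\<close>. Multiplying \<open>m i j\<close> by
    \<open>\<rho> i\<close> cancels \<open>v $ i\<close>, so the inner sums of the form become the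
    vanishing sums in \<open>left\<close>.\<close>
  define \<rho> where "\<rho> = (\<lambda>i. 1 / ((d i)\<^sup>2 * v $ i))"
  have "form (\<lambda>i. complex_of_real (\<rho> i)) = complex_of_real (\<Sum>i<n. \<Sum>j<n. m i j * \<rho> j * \<rho> i)"
    by (simp add: form_def)
  also have "(\<Sum>i<n. \<Sum>j<n. m i j * \<rho> j * \<rho> i) = (\<Sum>j<n. \<rho> j * (\<Sum>i<n. l i j / (d i)\<^sup>2))"
  proof (subst sum.swap, rule sum.cong[OF refl])
    fix j
    have "(\<Sum>i<n. m i j * \<rho> j * \<rho> i) = (\<Sum>i<n. \<rho> j * (l i j / (d i)\<^sup>2))"
    proof (rule sum.cong[OF refl])
      fix i assume "i \<in> {..<n}"
      then have "v $ i > 0" using v by simp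
      then show "m i j * \<rho> j * \<rho> i = \<rho> j * (l i j / (d i)\<^sup>2)" by (simp add: m_def \<rho>_def)
    qed
    then show "(\<Sum>i<n. m i j * \<rho> j * \<rho> i) = \<rho> j * (\<Sum>i<n. l i j / (d i)\<^sup>2)"
      by (simp add: sum_distrib_left)
  qed
  also have "\<dots> = 0" using left by simp
  finally have form0: "Re (form (\<lambda>i. complex_of_real (\<rho> i))) = 0" by simp
  \<comment> \<open>Only quotients of diagonal entries of \<open>D\<close> enter the similarity, so
    the undetermined scalar factor drops out here.\<close>
  have ratio: "d j / d i = sqrt (v $ i) / sqrt (v $ j)" if ij: "i < n" "j < n" for i j
  proof -
    have pos: "d i > 0" "d j > 0" "v $ i > 0" "v $ j > 0" using ij d v by auto
    have "\<rho> i = \<rho> j" using form_null_imp_constant[OF form0 ij] by simp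
    then have "(d j)\<^sup>2 * v $ j = (d i)\<^sup>2 * v $ i" using pos by (simp add: \<rho>_def field_simps)
    then have "sqrt ((d j)\<^sup>2 * v $ j) = sqrt ((d i)\<^sup>2 * v $ i)" by simp
    then have "d j * sqrt (v $ j) = d i * sqrt (v $ i)" using pos by (simp add: real_sqrt_mult)
    then show ?thesis using pos by (simp add: field_simps)
  qed
  show ?thesis
  proof (rule eq_matI)
    fix i j assume "i < dim_row (scaled (\<lambda>i. 1 / sqrt (v $ i)))" "j < dim_col (scaled (\<lambda>i. 1 / sqrt (v $ i)))"
    then have ij: "i < n" "j < n" by (auto simp: scaled_def)
    have "v $ i > 0" using ij v by simp
    then have div: "v $ i / sqrt (v $ i) = sqrt (v $ i)" by (simp add: real_div_sqrt)
    have "1 / sqrt (v $ i) * m i j * (1 / sqrt (v $ j)) = l i j * (v $ i / sqrt (v $ i) / sqrt (v $ j))"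
      by (simp add: m_def mult_ac)
    also have "\<dots> = l i j * (sqrt (v $ i) / sqrt (v $ j))" unfolding div ..
    also have "\<dots> = l i j * d j / d i" unfolding ratio[OF ij, symmetric] by simp
    finally show "similarity D L $$ (i, j) = scaled (\<lambda>i. 1 / sqrt (v $ i)) $$ (i, j)"
      by (simp only: C scaled_def index_mat(1)[OF ij] prod.case)
  qed (simp_all add: C scaled_def)
qed

lemma similarity_sqrt:
  "similarity (mat_diag n (\<lambda>i. complex_of_real (v $ i powr (- 1 / 2)))) (map_mat complex_of_real (laplacian n G w)) =
    scaled (\<lambda>i. 1 / sqrt (v $ i))"
proof -
  have p: "v $ i powr (- 1 / 2) = 1 / sqrt (v $ i)" "v $ i > 0" if "i < n" for i
    using v that by (auto simp: powr_minus_divide powr_half_sqrt less_imp_le simp flip: minus_divide_left)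
  have "map_mat complex_of_real (laplacian n G w) \<in> carrier_mat n n" using laplacian_carrier by simp
  moreover have "complex_of_real (v $ i powr (- 1 / 2)) \<noteq> 0" if "i < n" for i using p[OF that] by simp
  ultimately have "similarity (mat_diag n (\<lambda>i. complex_of_real (v $ i powr (- 1 / 2))))
      (map_mat complex_of_real (laplacian n G w)) =
      mat n n (\<lambda>(i, j). map_mat complex_of_real (laplacian n G w) $$ (i, j) *
        complex_of_real (v $ j powr (- 1 / 2)) / complex_of_real (v $ i powr (- 1 / 2)))"
    by (rule similarity_mat_diag)
  also have "\<dots> = scaled (\<lambda>i. 1 / sqrt (v $ i))"
  proof (rule eq_matI)
    fix i j assume "i < dim_row (scaled (\<lambda>i. 1 / sqrt (v $ i)))" "j < dim_col (scaled (\<lambda>i. 1 / sqrt (v $ i)))"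
    then have ij: "i < n" "j < n" by (auto simp: scaled_def)
    have div: "v $ i / sqrt (v $ i) = sqrt (v $ i)" using p(2)[OF ij(1)] by (simp add: real_div_sqrt)
    have "l i j * (1 / sqrt (v $ j)) / (1 / sqrt (v $ i)) = l i j * (v $ i / sqrt (v $ i) / sqrt (v $ j))"
      unfolding div by simp
    also have "\<dots> = 1 / sqrt (v $ i) * m i j * (1 / sqrt (v $ j))"
      by (simp add: m_def mult_ac)
    finally have "l i j * (1 / sqrt (v $ j)) / (1 / sqrt (v $ i)) = 1 / sqrt (v $ i) * m i j * (1 / sqrt (v $ j))" .
    then show "mat n n (\<lambda>(i, j). map_mat complex_of_real (laplacian n G w) $$ (i, j) *
        complex_of_real (v $ j powr (- 1 / 2)) / complex_of_real (v $ i powr (- 1 / 2))) $$ (i, j) =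
        scaled (\<lambda>i. 1 / sqrt (v $ i)) $$ (i, j)"
      using ij laplacian_carrier carrier_matD[OF laplacian_carrier]
      by (simp only: scaled_def index_mat(1)[OF ij] prod.case index_map_mat(1) p(1) flip: of_real_mult of_real_divide)
  qed (auto simp: scaled_def)
  finally show ?thesis .
qed

lemma scaled_one:
  "mat_diag n (\<lambda>i. complex_of_real (v $ i)) * map_mat complex_of_real (laplacian n G w) = scaled (\<lambda>_. 1)"
  using laplacian_carrier by (subst mat_diag_mult_left[of _ n n]) (auto simp: scaled_def m_def intro!: eq_matI)

end

theorem lemma7p3:
  fixes n :: nat
    and G :: "nat pair_pre_digraph"
    and w :: "nat \<times> nat \<Rightarrow> real"
    and v :: "real vec"
    and L V D\<^sub>0 :: "complex mat"
  assumes "pair_fin_digraph G"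
    and "pverts G = {..<n}"
    and "\<forall>e\<in>parcs G. w e > 0"
    and "strongly_connected (with_proj G)"
    and "v \<in> carrier_vec n"
    and "\<forall>i<n. v $ i > 0"
    and "transpose_mat (laplacian n G w) *\<^sub>v v = 0\<^sub>v n"
    and "L = map_mat complex_of_real (laplacian n G w)"
    and "V = mat_diag n (\<lambda>i. complex_of_real (v $ i))"
    and "D\<^sub>0 = mat_diag n (\<lambda>i. complex_of_real (v $ i powr (- 1 / 2)))"
  shows "ess_phase_max L = phase_max (similarity D\<^sub>0 L) \<and>
         phase_max (similarity D\<^sub>0 L) = phase_max (V * L) \<and>
         ess_phase_min L = phase_min (similarity D\<^sub>0 L) \<and>
         phase_min (similarity D\<^sub>0 L) = phase_min (V * L)"
proof -
  interpret balanced_laplacian n G w v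
    by unfold_locales (fact assms)+
  let ?s = "\<lambda>i. 1 / sqrt (v $ i)"
  let ?A = "{D \<in> pos_diag_mats (dim_row L). semi_sectorial (similarity D L)}"
  have D0: "similarity D\<^sub>0 L = scaled ?s" and VL: "V * L = scaled (\<lambda>_. 1)"
    using assms(8-10) similarity_sqrt scaled_one by simp_all
  have "angular_numerical_range (scaled ?s) = angular_numerical_range (scaled (\<lambda>_. 1))"
    using assms(6) by (subst (1 2) angular_numerical_range_scaled) auto
  then have eq: "phase_max (scaled ?s) = phase_max (scaled (\<lambda>_. 1))"
      "phase_min (scaled ?s) = phase_min (scaled (\<lambda>_. 1))"
    using phase_extremes_cong[OF quasi_accretive_scaled quasi_accretive_scaled] by blast+
  have dim: "dim_row L = n" using assms(8) laplacian_carrier by simp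
  \<comment> \<open>The infimum and supremum take the common value only over a nonempty index set;
    \<open>D\<^sub>0\<close> is the member that makes it nonempty.\<close>
  have "semi_sectorial (scaled ?s)"
    using quasi_accretive_quasi_sectorial[OF quasi_accretive_scaled[of ?s]]
    by (simp add: quasi_sectorial_def semi_sectorial_def)
  moreover have "D\<^sub>0 \<in> pos_diag_mats n"
    unfolding pos_diag_mats_def assms(10) using assms(6) by (intro CollectI exI[of _ "\<lambda>i. v $ i powr (- 1 / 2)"]) (auto simp: powr_gt_zero)
  ultimately have ne: "?A \<noteq> {}" unfolding dim using D0 by auto
  have all: "similarity D L = scaled ?s" if "D \<in> ?A" for D
    using that similarity_semi_sectorial_eq unfolding dim by (auto simp: pos_diag_mats_def assms(8))
  have "ess_phase_max L = phase_max (scaled ?s)"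
    unfolding ess_phase_max_def by (rule INF_eq_const[OF ne]) (simp only: all)
  moreover have "ess_phase_min L = phase_min (scaled ?s)"
    unfolding ess_phase_min_def by (rule SUP_eq_const[OF ne]) (simp only: all)
  ultimately show ?thesis using eq by (simp add: D0 VL)
qed

end
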